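(* Let $1\le i<\mathfrak n$ and $m\in M^{(i)}$. Then $$\lim_{\beta\to\infty}\frac1\beta\ln\mathbb E_r\zeta_0=E(s_m)-E(m)$$ for any $r\in V^{(i)}(m)$.
   Context: **Setting.** $\mathcal S$ is a finite set and $E:\mathcal S\to\mathbb R$ satisfies $E(r)\neq E(s)$ for $r\ne s$. For each $\beta>0$, $X=(X_n)_{n\ge0}$ is a Markov chain on $\mathcal S$ with transition matrix $(p(r,s))_{r,s\in\mathcal S}$ (depending on $\beta$) and stationary distribution $\pi$ such that: (i) the chain is irreducible, $p(s,s)>0$, $p(r,s)>0\iff p(s,r)>0$, and the set of pairs with $p(r,s)>0$ does not depend on $\beta$; (ii) there are $\gamma_\beta>0$ with $\gamma_\beta\to0$, $\beta\gamma_\beta\to\infty$ as $\beta\to\infty$ and $e^{-\beta((E(s)-E(r))^++\gamma_\beta/|\mathcal S|)}\le p(r,s)\le e^{-\beta((E(s)-E(r))^+-\gamma_\beta/|\mathcal S|)}$ for all distinct $r,s$ with $p(r,s)>0$; (iii) $p^*(r,s):=\lim_{\beta\to\infty}p(r,s)$ exists for all $r,s$ and, for pairs with $p(r,s)>0$, is positive if $E(r)\ge E(s)$ and $0$ otherwise; (iv) $\pi(r)p(r,s)=\pi(s)p(s,r)$. Distinct states $r,s$ are neighbours, $r\sim s$, if $p(r,s)>0$. $\mathbb E_x$ refers to the chain started at $x$. **Essential saddles.** For $r\neq s$, $\Gamma(r,s)$ is the set of self-avoiding paths $(\gamma_0,\dots,\gamma_k)$ with $\gamma_0=r$, $\gamma_k=s$,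 $p(\gamma_l,\gamma_{l+1})>0$. A path in $\Gamma(r,s)$ is minimal if its maximal energy $\max_l E(\gamma_l)$ is minimal within $\Gamma(r,s)$. The essential saddle $z^*(r,s)$ is the state of maximal energy on any minimal path from $r$ to $s$ (well defined since $E$ is injective); $z^*(s,s):=s$. **Metastable states.** $M^{(1)}:=\{s: E(s)<E(r)\text{ for all }r\sim s\}$, $\mathfrak n:=|M^{(1)}|$. For $1\le i<\mathfrak n$, $M^{(i+1)}:=M^{(i)}\setminus\{m^{(i)}\}$, where $m^{(i)}$ is the $m\in M^{(i)}$ with minimal activation energy $\min_{n\in M^{(i)}\setminus\{m\}}E(z^*(m,n))-E(m)$ for a transition to another element of $M^{(i)}$ (ties broken arbitrarily); $m^{(\mathfrak n)}$ is the last remaining element. So $M^{(i)}=\{m^{(i)},\dots,m^{(\mathfrak n)}\}$. **Attraction.** For $m\in M^{(i)}$, $V^{(i)}_<(m):=\{s: E(z^*(s,m))<E(z^*(s,m'))\ \forall m'\in M^{(i)}\setminus\{m\}\}$. State $s$ is attracted by $m$ at level $i$ ($s\leadsto m$ at level $i$) if $E(z^*(s,m))=\min_{n\in M^{(i)}}E(z^*(s,n))$ and every minimal path from $s$ to any $m'\in M^{(i)}\setminus\{m\}$ with $E(z^*(s,m'))=E(z^*(s,m))$ hits $V^{(i)}_<(m)$. Let $l(i):=\inf\{j: i<j\le\mathfrak n,\ m^{(i)}\leadsto m\text{ at level }j\text{ for some }m\in M^{(j)}\}$ ($\inf\emptyset=\infty$). **Valleys.** $V^{(1)}(m):=\{s: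 s\leadsto m\text{ at level }1\}$ for $m\in M^{(1)}$, $N^{(1)}:=(\bigcup_{j=1}^{\mathfrak n}V^{(1)}(m^{(j)}))^c$. For $2\le i\le\mathfrak n$, $m\in M^{(i)}$: $V^{(i)}(m):=V^{(i-1)}(m)\cup\{s\in N^{(i-1)}: s\leadsto m\text{ at level }i\}\cup\bigcup_{j:\,l(j)=i,\ m^{(j)}\leadsto m\text{ at level }i}V^{(j)}(m^{(j)})$, and $N^{(i)}:=(\bigcup_{j=1}^{\mathfrak n}V^{(i\wedge j)}(m^{(j)}))^c$ (non-assigned states). **Exit.** $\partial^+V$ is the set of states outside $V$ adjacent to a state of $V$, and $s_m:=\operatorname{argmin}_{s\in\partial^+V^{(i)}(m)}E(s)$. With $\xi_0:=\inf\{n\ge0:X_n\notin N^{(i)}\}$, $\zeta_0:=\inf\{k\ge\xi_0:X_k\in N^{(i)}\}$. *)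

theory Defs
  imports "HOL-Probability.Probability"
begin

section \<open>The Markov chains\<close>

definition transition_matrix :: "('s::finite \<Rightarrow> 's \<Rightarrow> real) \<Rightarrow> bool" where
  "transition_matrix Q \<longleftrightarrow> (\<forall>r s. 0 \<le> Q r s) \<and> (\<forall>r. (\<Sum>s\<in>UNIV. Q r s) = 1)"

definition irreducible_matrix :: "('s \<Rightarrow> 's \<Rightarrow> real) \<Rightarrow> bool" where
  "irreducible_matrix Q \<longleftrightarrow> (\<forall>r s. (\<lambda>a b. 0 < Q a b)\<^sup>*\<^sup>* r s)"

definition stationary_distribution :: "('s::finite \<Rightarrow> 's \<Rightarrow> real) \<Rightarrow> ('s \<Rightarrow> real) \<Rightarrow> bool" where
  "stationary_distribution Q \<mu> \<longleftrightarrow>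
     (\<forall>s. 0 \<le> \<mu> s) \<and> (\<Sum>s\<in>UNIV. \<mu> s) = 1 \<and> (\<forall>s. (\<Sum>r\<in>UNIV. \<mu> r * Q r s) = \<mu> s)"

text \<open>
  The time-homogeneous Markov chain with transition matrix \<open>Q\<close> started at \<open>x\<close>, realised as a
  process \<open>Y\<close> on the probability space \<open>W\<close>.
\<close>

definition markov_chain_from ::
    "'w measure \<Rightarrow> (nat \<Rightarrow> 'w \<Rightarrow> 's) \<Rightarrow> ('s \<Rightarrow> 's \<Rightarrow> real) \<Rightarrow> 's \<Rightarrow> bool" where
  "markov_chain_from W Y Q x \<longleftrightarrow>
     prob_space W \<and>
     (\<forall>n. Y n \<in> measurable W (count_space UNIV)) \<and>
     (AE \<omega> in W. Y 0 \<omega> = x) \<and>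
     (\<forall>n h t. \<P>(\<omega> in W. \<forall>k\<le>n. Y k \<omega> = h k) > 0 \<longrightarrow>
        \<P>(\<omega> in W. Y (Suc n) \<omega> = t \<bar> \<forall>k\<le>n. Y k \<omega> = h k) = Q (h n) t)"

text \<open>
  \<open>K r s\<close> is the relation \<open>p(r,s) > 0\<close>, which is the same for all \<open>\<beta> > 0\<close>; it contains the
  diagonal.
\<close>

locale metastable_chain =
  fixes E :: "'s::finite \<Rightarrow> real"
    and K :: "'s \<Rightarrow> 's \<Rightarrow> bool"
    and p :: "real \<Rightarrow> 's \<Rightarrow> 's \<Rightarrow> real"
    and pstar :: "'s \<Rightarrow> 's \<Rightarrow> real"
    and \<pi> :: "real \<Rightarrow> 's \<Rightarrow> real"
    and \<gamma> :: "real \<Rightarrow> real"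
  assumes E_inj: "inj E"
    and transition: "\<And>\<beta>. 0 < \<beta> \<Longrightarrow> transition_matrix (p \<beta>)"
    and stationary: "\<And>\<beta>. 0 < \<beta> \<Longrightarrow> stationary_distribution (p \<beta>) (\<pi> \<beta>)"
    and irreducible: "\<And>\<beta>. 0 < \<beta> \<Longrightarrow> irreducible_matrix (p \<beta>)"
    and diagonal_pos: "\<And>\<beta> s. 0 < \<beta> \<Longrightarrow> 0 < p \<beta> s s"
    and pos_sym: "\<And>\<beta> r s. 0 < \<beta> \<Longrightarrow> 0 < p \<beta> r s \<longleftrightarrow> 0 < p \<beta> s r"
    and pos_iff: "\<And>\<beta> r s. 0 < \<beta> \<Longrightarrow> 0 < p \<beta> r s \<longleftrightarrow> K r s"
    and gamma_pos: "\<And>\<beta>. 0 < \<beta> \<Longrightarrow> 0 < \<gamma> \<beta>"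
    and gamma_lim: "(\<gamma> \<longlongrightarrow> 0) at_top"
    and beta_gamma_lim: "filterlim (\<lambda>\<beta>. \<beta> * \<gamma> \<beta>) at_top at_top"
    and p_lower: "\<And>\<beta> r s. 0 < \<beta> \<Longrightarrow> r \<noteq> s \<Longrightarrow> K r s \<Longrightarrow>
        exp (- \<beta> * (max 0 (E s - E r) + \<gamma> \<beta> / real CARD('s))) \<le> p \<beta> r s"
    and p_upper: "\<And>\<beta> r s. 0 < \<beta> \<Longrightarrow> r \<noteq> s \<Longrightarrow> K r s \<Longrightarrow>
        p \<beta> r s \<le> exp (- \<beta> * (max 0 (E s - E r) - \<gamma> \<beta> / real CARD('s)))"
    and pstar_lim: "\<And>r s. ((\<lambda>\<beta>. p \<beta> r s) \<longlongrightarrow> pstar r s) at_top"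
    and pstar_pos: "\<And>r s. K r s \<Longrightarrow> E s \<le> E r \<Longrightarrow> 0 < pstar r s"
    and pstar_zero: "\<And>r s. K r s \<Longrightarrow> E r < E s \<Longrightarrow> pstar r s = 0"
    and reversible: "\<And>\<beta> r s. 0 < \<beta> \<Longrightarrow> \<pi> \<beta> r * p \<beta> r s = \<pi> \<beta> s * p \<beta> s r"


section \<open>Paths and essential saddles\<close>

definition neighbour :: "('s \<Rightarrow> 's \<Rightarrow> bool) \<Rightarrow> 's \<Rightarrow> 's \<Rightarrow> bool" where
  "neighbour K r s \<longleftrightarrow> r \<noteq> s \<and> K r s"

text \<open>For \<open>r = s\<close> this contains only the trivial path \<open>[s]\<close>.\<close>

definition sa_paths :: "('s \<Rightarrow> 's \<Rightarrow> bool) \<Rightarrow> 's \<Rightarrow> 's \<Rightarrow> 's list set" where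
  "sa_paths K r s = {g. g \<noteq> [] \<and> distinct g \<and> hd g = r \<and> last g = s \<and> successively K g}"

definition minimal_paths ::
    "('s \<Rightarrow> real) \<Rightarrow> ('s \<Rightarrow> 's \<Rightarrow> bool) \<Rightarrow> 's \<Rightarrow> 's \<Rightarrow> 's list set" where
  "minimal_paths E K r s =
     {g. is_arg_min (\<lambda>g. Max (E ` set g)) (\<lambda>g. g \<in> sa_paths K r s) g}"

definition essential_saddle ::
    "('s \<Rightarrow> real) \<Rightarrow> ('s \<Rightarrow> 's \<Rightarrow> bool) \<Rightarrow> 's \<Rightarrow> 's \<Rightarrow> 's" where
  "essential_saddle E K r s =
     (if r = s then s
      else (THE z. \<forall>g\<in>minimal_paths E K r s. is_arg_max E (\<lambda>x. x \<in> set g) z))"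


section \<open>Metastable states\<close>

text \<open>
  From here on \<open>m i\<close> (for \<open>1 \<le> i \<le> n_meta E K\<close>) is the metastable state removed at step \<open>i\<close>.
  Levels start at 1; the values of level-indexed objects at level 0 are irrelevant.
\<close>

definition local_minima :: "('s \<Rightarrow> real) \<Rightarrow> ('s \<Rightarrow> 's \<Rightarrow> bool) \<Rightarrow> 's set" where
  "local_minima E K = {s. \<forall>r. neighbour K r s \<longrightarrow> E s < E r}"

definition n_meta :: "('s \<Rightarrow> real) \<Rightarrow> ('s \<Rightarrow> 's \<Rightarrow> bool) \<Rightarrow> nat" where
  "n_meta E K = card (local_minima E K)"

fun meta_states ::
    "('s \<Rightarrow> real) \<Rightarrow> ('s \<Rightarrow> 's \<Rightarrow> bool) \<Rightarrow> (nat \<Rightarrow> 's) \<Rightarrow> nat \<Rightarrow> 's set" where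
  "meta_states E K m 0 = {}"
| "meta_states E K m (Suc 0) = local_minima E K"
| "meta_states E K m (Suc (Suc i)) = meta_states E K m (Suc i) - {m (Suc i)}"

definition activation_energy ::
    "('s \<Rightarrow> real) \<Rightarrow> ('s \<Rightarrow> 's \<Rightarrow> bool) \<Rightarrow> 's set \<Rightarrow> 's \<Rightarrow> real" where
  "activation_energy E K A x =
     Min ((\<lambda>n. E (essential_saddle E K x n)) ` (A - {x})) - E x"

text \<open>Ties are broken arbitrarily: every \<open>m\<close> satisfying the following is admitted.\<close>

definition meta_enumeration ::
    "('s \<Rightarrow> real) \<Rightarrow> ('s \<Rightarrow> 's \<Rightarrow> bool) \<Rightarrow> (nat \<Rightarrow> 's) \<Rightarrow> bool" where
  "meta_enumeration E K m \<longleftrightarrow>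
     (\<forall>i. 1 \<le> i \<and> i < n_meta E K \<longrightarrow>
        is_arg_min (activation_energy E K (meta_states E K m i))
          (\<lambda>x. x \<in> meta_states E K m i) (m i)) \<and>
     m (n_meta E K) \<in> meta_states E K m (n_meta E K)"


section \<open>Attraction\<close>

definition strict_valley ::
    "('s \<Rightarrow> real) \<Rightarrow> ('s \<Rightarrow> 's \<Rightarrow> bool) \<Rightarrow> (nat \<Rightarrow> 's) \<Rightarrow> nat \<Rightarrow> 's \<Rightarrow> 's set" where
  "strict_valley E K m i x =
     {s. \<forall>y\<in>meta_states E K m i - {x}.
           E (essential_saddle E K s x) < E (essential_saddle E K s y)}"

text \<open>\<open>attracted E K m i s x\<close>: the state \<open>s\<close> is attracted by \<open>x\<close> at level \<open>i\<close>.\<close>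

definition attracted ::
    "('s \<Rightarrow> real) \<Rightarrow> ('s \<Rightarrow> 's \<Rightarrow> bool) \<Rightarrow> (nat \<Rightarrow> 's) \<Rightarrow> nat \<Rightarrow> 's \<Rightarrow> 's \<Rightarrow> bool" where
  "attracted E K m i s x \<longleftrightarrow>
     x \<in> meta_states E K m i \<and>
     E (essential_saddle E K s x) =
       Min ((\<lambda>n. E (essential_saddle E K s n)) ` meta_states E K m i) \<and>
     (\<forall>y\<in>meta_states E K m i - {x}.
        E (essential_saddle E K s y) = E (essential_saddle E K s x) \<longrightarrow>
        (\<forall>g\<in>minimal_paths E K s y. set g \<inter> strict_valley E K m i x \<noteq> {}))"

definition merge_level ::
    "('s \<Rightarrow> real) \<Rightarrow> ('s \<Rightarrow> 's \<Rightarrow> bool) \<Rightarrow> (nat \<Rightarrow> 's) \<Rightarrow> nat \<Rightarrow> enat" where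
  "merge_level E K m i =
     Inf {enat j | j. i < j \<and> j \<le> n_meta E K \<and>
                      (\<exists>x\<in>meta_states E K m j. attracted E K m j (m i) x)}"


section \<open>Valleys\<close>

text \<open>
  In the last union the restriction \<open>j < i\<close> is implied by \<open>merge_level E K m j = i\<close>; it is
  spelled out so that the recursion is seen to terminate.
\<close>

function (sequential)
    valley :: "('s \<Rightarrow> real) \<Rightarrow> ('s \<Rightarrow> 's \<Rightarrow> bool) \<Rightarrow> (nat \<Rightarrow> 's) \<Rightarrow> nat \<Rightarrow> 's \<Rightarrow> 's set"
and non_assigned :: "('s \<Rightarrow> real) \<Rightarrow> ('s \<Rightarrow> 's \<Rightarrow> bool) \<Rightarrow> (nat \<Rightarrow> 's) \<Rightarrow> nat \<Rightarrow> 's set"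
where
  "valley E K m 0 x = {}"
| "valley E K m (Suc 0) x = {s. attracted E K m 1 s x}"
| "valley E K m (Suc (Suc i)) x =
     valley E K m (Suc i) x \<union>
     {s \<in> non_assigned E K m (Suc i). attracted E K m (Suc (Suc i)) s x} \<union>
     (\<Union>j\<in>{j. 1 \<le> j \<and> j < Suc (Suc i) \<and> merge_level E K m j = enat (Suc (Suc i)) \<and>
              attracted E K m (Suc (Suc i)) (m j) x}. valley E K m j (m j))"
| "non_assigned E K m i = - (\<Union>j\<in>{1..n_meta E K}. valley E K m (min i j) (m j))"
  by pat_completeness auto
termination
  by (relation "Wellfounded.measure (\<lambda>a. case a of Inl (E, K, m, i, x) \<Rightarrow> 2 * i
                                                 | Inr (E, K, m, i) \<Rightarrow> 2 * i + 1)") auto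


section \<open>Exit\<close>

definition outer_boundary :: "('s \<Rightarrow> 's \<Rightarrow> bool) \<Rightarrow> 's set \<Rightarrow> 's set" where
  "outer_boundary K V = {s. s \<notin> V \<and> (\<exists>r\<in>V. neighbour K r s)}"

definition exit_state ::
    "('s \<Rightarrow> real) \<Rightarrow> ('s \<Rightarrow> 's \<Rightarrow> bool) \<Rightarrow> (nat \<Rightarrow> 's) \<Rightarrow> nat \<Rightarrow> 's \<Rightarrow> 's" where
  "exit_state E K m i x = arg_min_on E (outer_boundary K (valley E K m i x))"

definition xi0 :: "'s set \<Rightarrow> (nat \<Rightarrow> 'w \<Rightarrow> 's) \<Rightarrow> 'w \<Rightarrow> enat" where
  "xi0 N Y \<omega> = Inf {enat n | n. Y n \<omega> \<notin> N}"

definition zeta0 :: "'s set \<Rightarrow> (nat \<Rightarrow> 'w \<Rightarrow> 's) \<Rightarrow> 'w \<Rightarrow> enat" where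
  "zeta0 N Y \<omega> = Inf {enat k | k. xi0 N Y \<omega> \<le> enat k \<and> Y k \<omega> \<in> N}"

text \<open>
  Expectations are taken in \<open>[0, \<infinity>]\<close>, with \<open>ln 0 = - \<infinity>\<close> and \<open>ln \<infinity> = \<infinity>\<close>, so that a finite limit
  of \<open>ln\<close> of an expectation includes its eventual finiteness and positivity.
\<close>

definition ln_ennreal :: "ennreal \<Rightarrow> ereal" where
  "ln_ennreal a = (if a = 0 then - \<infinity> else if a = \<infinity> then \<infinity> else ereal (ln (enn2real a)))"

definition expected_zeta0 :: "'w measure \<Rightarrow> 's set \<Rightarrow> (nat \<Rightarrow> 'w \<Rightarrow> 's) \<Rightarrow> ennreal" where
  "expected_zeta0 W N Y = (\<integral>\<^sup>+ \<omega>. ennreal_of_enat (zeta0 N Y \<omega>) \<partial>W)"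

end

theory Submission
  imports Defs
begin

text \<open>
  Write \<open>H(a,b)\<close> for the energy of the essential saddle of \<open>a\<close> and \<open>b\<close>, the level below which \<open>a\<close> and
  \<open>b\<close> can just be connected. It is symmetric and satisfies the ultrametric inequality. All
  arguments about paths are arguments about connectivity inside sublevel sets of \<open>E\<close>, possibly with
  a set removed (\<open>joined\<close>). Let \<open>M\<close> be the metastable states and \<open>N\<close> the non-assigned states of level \<open>i\<close>, let
  \<open>V\<close> be the valley of \<open>x\<close>, and let \<open>B\<close> be the smallest \<open>H(x,y)\<close> over the other \<open>y\<close> in \<open>M\<close>. The
  chain starts in \<open>V\<close>, hence outside \<open>N\<close>, and the time in question is the hitting time of \<open>N\<close>.

  Energy landscape. Every assigned state is attracted for the first time at a unique level, by a
  unique minimum, and then follows the mergers of that minimum into others; a valley consists of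
  the states whose chain of mergers up to level \<open>i\<close> ends at its minimum (\<open>valley_chain\<close>, \<open>V_chain\<close>). What makes
  this consistent is \<open>attracted_among_forward\<close>: if a state is attracted first by \<open>a\<close> and later by
  \<open>n\<close>, then \<open>a\<close> is attracted by \<open>n\<close>. It follows that one can leave \<open>V\<close> only through \<open>N\<close>
  (\<open>V_closed\<close>), that the lowest energy on the outer boundary of \<open>V\<close> is exactly \<open>B\<close>
  (\<open>exit_energy\<close>), and that from every state some element of \<open>M\<close> other than \<open>x\<close> can be reached by
  climbing at most \<open>D = B - E(x)\<close> (\<open>depth\<close>). So the limit to be established is \<open>D\<close>.

  Upper bound. Up to the time at which \<open>N\<close> is hit, the chain has not seen an element of \<open>M\<close> other
  than \<open>x\<close>, so \<open>N\<close> may be enlarged by these states. The expected exit time is the sum over all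
  \<open>u\<close> of the expected number of visits to \<open>u\<close>, which is largest when the chain starts in \<open>u\<close>
  itself. This number is the diagonal value of a Green function, whose Dirichlet form is bounded by
  that same value times the weight of \<open>u\<close>; comparing the two along a path of height \<open>E(u) + D\<close>
  bounds the value by \<open>exp(\<beta> (D + o(1)))\<close> (\<open>green_bound\<close>).

  Lower bound. Started from the reversible measure restricted to the strict valley of \<open>x\<close>, the
  chain loses in each step at most the flow out of it, which is of order \<open>exp(- \<beta> B)\<close>
  (\<open>survival_lower\<close>); this bounds the exit time from \<open>x\<close>. A state attracted by \<open>z\<close> reaches \<open>z\<close>
  before \<open>N\<close> with probability at least \<open>1/4\<close> at low temperature (\<open>survival_attracted\<close>): by the
  Dirichlet principle it is likely to hit \<open>z\<close> before climbing above their saddle, and by the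
  definition of attraction everything it meets until it enters the strict valley of \<open>z\<close> is
  attracted by \<open>z\<close> too. Applied along a chain of mergers this transfers the lower bound from \<open>x\<close> to
  every state of \<open>V\<close>.
\<close>

section \<open>Paths and energy barriers\<close>

definition joined :: "('s \<Rightarrow> 's \<Rightarrow> bool) \<Rightarrow> 's set \<Rightarrow> 's \<Rightarrow> 's \<Rightarrow> bool" where
  "joined K S a b \<longleftrightarrow> a \<in> S \<and> (\<lambda>x y. K x y \<and> y \<in> S)\<^sup>*\<^sup>* a b"

lemma joined_refl [simp]: "joined K S a a \<longleftrightarrow> a \<in> S"
  by (simp add: joined_def)

lemma joined_step: "joined K S a b \<Longrightarrow> K b c \<Longrightarrow> c \<in> S \<Longrightarrow> joined K S a c"
  unfolding joined_def by (metis (mono_tags, lifting) rtranclp.rtrancl_into_rtrancl)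

lemma joined_edge: "a \<in> S \<Longrightarrow> b \<in> S \<Longrightarrow> K a b \<Longrightarrow> joined K S a b"
  using joined_step[of K S a a b] by simp

lemma joined_trans: "joined K S a b \<Longrightarrow> joined K S b c \<Longrightarrow> joined K S a c"
  unfolding joined_def by (meson rtranclp_trans)

lemma joined_right: "joined K S a b \<Longrightarrow> b \<in> S"
  unfolding joined_def by (metis (mono_tags, lifting) rtranclp.cases)

lemma joined_left: "joined K S a b \<Longrightarrow> a \<in> S"
  unfolding joined_def by simp

lemma joined_induct [consumes 1, case_names refl step]:
  assumes "joined K S a b" "a \<in> S \<Longrightarrow> P a"
    and "\<And>b c. joined K S a b \<Longrightarrow> K b c \<Longrightarrow> c \<in> S \<Longrightarrow> P b \<Longrightarrow> P c"
  shows "P b"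
proof -
  have "a \<in> S" using assms(1) by (rule joined_left)
  have "(\<lambda>x y. K x y \<and> y \<in> S)\<^sup>*\<^sup>* a b" using assms(1) unfolding joined_def by simp
  then show ?thesis
  proof (induction rule: rtranclp_induct)
    case base then show ?case using assms(2) \<open>a \<in> S\<close> by simp
  next
    case (step y z)
    then show ?case using assms(3)[of y z] \<open>a \<in> S\<close> unfolding joined_def by simp
  qed
qed

lemma joined_mono: "joined K S a b \<Longrightarrow> S \<subseteq> T \<Longrightarrow> joined K T a b"
  by (induction rule: joined_induct) (auto intro: joined_step)

text \<open>
  The state \<open>v\<close> is the last one before the first visit to \<open>U\<close>, which may happen at the start.
\<close>

lemma joined_first_visit:
  assumes "joined K S a b"
  shows "joined K (S - U) a b \<or>
         (\<exists>u\<in>U. joined K S u b \<and> (u = a \<or> (\<exists>v. joined K (S - U) a v \<and> K v u)))"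
  using assms
proof (induction rule: joined_induct)
  case refl then show ?case by (cases "a \<in> U") (auto intro!: bexI[of _ a])
next
  case (step b c)
  show ?case
  proof (cases "joined K (S - U) a b")
    case True
    then show ?thesis using step(2,3) by (cases "c \<in> U") (auto intro: joined_step)
  next
    case False
    then show ?thesis using step by (meson joined_step)
  qed
qed

text \<open>
  The weak form of the first-visit statement that suffices when only heights are compared.
\<close>

lemma joined_through:
  assumes "joined K S a b" "\<not> joined K (S - U) a b"
  obtains u where "u \<in> U" "joined K S a u" "joined K S u b"
proof -
  obtain u where u: "u \<in> U" "joined K S u b" "u = a \<or> (\<exists>v. joined K (S - U) a v \<and> K v u)"
    using joined_first_visit[OF assms(1), of U] assms(2) by auto
  have "joined K S a u"
  proof (cases "u = a")
    case True
    then show ?thesis using u(2) by (simp add: joined_left)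
  next
    case False
    then obtain v where v: "joined K (S - U) a v" "K v u" using u(3) by auto
    have "joined K S a v" using v(1) by (rule joined_mono) auto
    then show ?thesis using v(2) joined_left[OF u(2)] by (rule joined_step)
  qed
  then show ?thesis using u that by simp
qed

lemma joined_stays:
  assumes "joined K S a b" "\<And>v. joined K S a v \<Longrightarrow> v \<in> T"
  shows "joined K T a b"
  using assms(1) by (induction rule: joined_induct) (auto intro: joined_step assms(2))

locale energy_landscape =
  fixes E :: "'s::finite \<Rightarrow> real" and K :: "'s \<Rightarrow> 's \<Rightarrow> bool"
  assumes inj_E: "inj E"
    and K_sym: "K a b \<Longrightarrow> K b a"
    and K_connected: "K\<^sup>*\<^sup>* a b"
begin

lemma joined_sym: "joined K S a b \<Longrightarrow> joined K S b a"
proof (induction rule: joined_induct)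
  case (step b c)
  have "joined K S c b" 
    using step.hyps joined_right by (intro joined_edge) (auto intro: K_sym)
  then show ?case using step.IH by (rule joined_trans)
qed simp

lemma joined_UNIV: "joined K UNIV a b"
  using K_connected by (simp add: joined_def)

lemma joined_iff_sa_path: "joined K S a b \<longleftrightarrow> (\<exists>g\<in>sa_paths K a b. set g \<subseteq> S)"
proof
  assume "joined K S a b"
  then show "\<exists>g\<in>sa_paths K a b. set g \<subseteq> S"
  proof (induction rule: joined_induct)
    case refl
    then show ?case by (intro bexI[of _ "[a]"]) (auto simp: sa_paths_def)
  next
    case (step b c)
    then obtain g where g: "g \<in> sa_paths K a b" "set g \<subseteq> S" by blast
    show ?case
    proof (cases "c \<in> set g")
      case True
      then obtain xs ys where "g = xs @ c # ys" by (meson split_list)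
      then have "xs @ [c] \<in> sa_paths K a c" "set (xs @ [c]) \<subseteq> S"
        using g by (auto simp: sa_paths_def successively_append_iff hd_append split: if_splits)
      then show ?thesis by blast
    next
      case False
      then have "g @ [c] \<in> sa_paths K a c" "set (g @ [c]) \<subseteq> S"
        using g step by (auto simp: sa_paths_def successively_append_iff)
      then show ?thesis by blast
    qed
  qed
next
  assume "\<exists>g\<in>sa_paths K a b. set g \<subseteq> S"
  then obtain g where "g \<in> sa_paths K a b" "set g \<subseteq> S" by blast
  then have "g \<noteq> []" "hd g = a" "last g = b" "successively K g" "set g \<subseteq> S"
    by (auto simp: sa_paths_def)
  then show "joined K S a b"
  proof (induction g arbitrary: a)
    case (Cons x g)
    show ?case
    proof (cases g)
      case Nil then show ?thesis using Cons by auto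
    next
      case (Cons y h)
      then have "joined K S y b" using Cons.IH[of y] Cons.prems by auto
      moreover have "joined K S x y" using Cons Cons.prems by (intro joined_edge) auto
      ultimately show ?thesis using Cons.prems joined_trans by fastforce
    qed
  qed simp
qed

lemma finite_sa_paths: "finite (sa_paths K a b)"
proof -
  have "length g \<le> CARD('s)" if "g \<in> sa_paths K a b" for g
    using that card_mono[of UNIV "set g"] by (simp add: sa_paths_def distinct_card)
  then have "sa_paths K a b \<subseteq> {g. set g \<subseteq> UNIV \<and> length g \<le> CARD('s)}" by blast
  then show ?thesis by (rule finite_subset) (rule finite_lists_length_le, simp)
qed

lemma sa_paths_nonempty: "sa_paths K a b \<noteq> {}"
  using joined_iff_sa_path[of UNIV a b] joined_UNIV by blast

text \<open>
  The edge bound is summed along a self-avoiding path, whose length is at most the number of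
  states.
\<close>

lemma path_difference:
  fixes f :: "'s \<Rightarrow> real"
  assumes "joined K S a b" "\<And>u v. u \<in> S \<Longrightarrow> v \<in> S \<Longrightarrow> K u v \<Longrightarrow> \<bar>f u - f v\<bar> \<le> \<delta>" "0 \<le> \<delta>"
  shows "\<bar>f a - f b\<bar> \<le> real CARD('s) * \<delta>"
proof -
  have *: "\<bar>f (hd g) - f (last g)\<bar> \<le> real (length g) * \<delta>"
    if "g \<noteq> []" "successively K g" "set g \<subseteq> S" for g
    using that
  proof (induction g)
    case (Cons x g)
    show ?case
    proof (cases g)
      case Nil
      then show ?thesis using assms(3) by simp
    next
      case (Cons y h)
      have "\<bar>f y - f (last g)\<bar> \<le> real (length g) * \<delta>" using Cons.IH Cons.prems Cons by auto
      moreover have "\<bar>f x - f y\<bar> \<le> \<delta>" using Cons.prems Cons by (intro assms(2)) auto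
      ultimately show ?thesis using Cons by (simp add: algebra_simps)
    qed
  qed simp
  obtain g where g: "g \<in> sa_paths K a b" "set g \<subseteq> S" using assms(1) joined_iff_sa_path by auto
  then have "\<bar>f a - f b\<bar> \<le> real (length g) * \<delta>" using *[of g] by (auto simp: sa_paths_def)
  also have "length g \<le> CARD('s)"
    using g(1) card_mono[of UNIV "set g"] by (simp add: sa_paths_def distinct_card)
  then have "real (length g) * \<delta> \<le> real CARD('s) * \<delta>" using assms(3) by (intro mult_right_mono) auto
  finally show ?thesis .
qed

definition peak :: "'s list \<Rightarrow> real" where "peak g = Max (E ` set g)"

lemma minimal_paths_iff:
  "g \<in> minimal_paths E K a b \<longleftrightarrow>
     g \<in> sa_paths K a b \<and> (\<forall>g'\<in>sa_paths K a b. peak g \<le> peak g')"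
  unfolding minimal_paths_def is_arg_min_def peak_def by (auto simp: not_less)

lemma minimal_path_exists: "minimal_paths E K a b \<noteq> {}"
proof -
  have "Min (peak ` sa_paths K a b) \<in> peak ` sa_paths K a b"
    using finite_sa_paths sa_paths_nonempty by (intro Min_in) auto
  then obtain g where "g \<in> sa_paths K a b" "peak g = Min (peak ` sa_paths K a b)" by auto
  then have "g \<in> minimal_paths E K a b"
    unfolding minimal_paths_iff using finite_sa_paths[of a b] by (auto intro!: Min_le)
  then show ?thesis by blast
qed

abbreviation height :: "'s \<Rightarrow> 's \<Rightarrow> real" where
  "height a b \<equiv> E (essential_saddle E K a b)"

text \<open>
  Two minimal paths have the same maximal energy, hence by injectivity of \<open>E\<close> the same state of
  maximal energy, so that the definite description in the essential saddle is meaningful.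
\<close>

lemma height_minimal_path:
  assumes g: "g \<in> minimal_paths E K a b"
  shows "height a b = peak g"
proof (cases "a = b")
  case True
  have "g \<noteq> []" "distinct g" "hd g = last g" "hd g = a" using g True
    by (auto simp: minimal_paths_iff sa_paths_def)
  then have "g = [a]" by (cases g) (auto split: if_splits)
  then show ?thesis using True by (simp add: essential_saddle_def peak_def)
next
  case False
  have *: "is_arg_max E (\<lambda>x. x \<in> set g') z \<longleftrightarrow> z \<in> set g' \<and> E z = peak g'" if "g' \<noteq> []" for g' z
  proof -
    have "E z = peak g' \<longleftrightarrow> (\<forall>y\<in>set g'. E y \<le> E z)" if "z \<in> set g'"
      using that \<open>g' \<noteq> []\<close> unfolding peak_def by (subst eq_commute, subst Max_eq_iff) auto
    then show ?thesis unfolding is_arg_max_def by (auto simp: not_less)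
  qed
  have ne: "g' \<noteq> []" if "g' \<in> minimal_paths E K a b" for g'
    using that by (auto simp: minimal_paths_iff sa_paths_def)
  have lev: "peak g' = peak g" if "g' \<in> minimal_paths E K a b" for g'
    using that g by (auto simp: minimal_paths_iff intro: antisym)
  have "peak g' \<in> E ` set g'" if "g' \<noteq> []" for g'
    unfolding peak_def using that by (intro Max_in) auto
  then have ex: "\<exists>z. z \<in> set g' \<and> E z = peak g'" if "g' \<noteq> []" for g' using that by force
  obtain z where z: "z \<in> set g" "E z = peak g" using ex[OF ne[OF g]] by blast
  have "essential_saddle E K a b = z"
    unfolding essential_saddle_def if_not_P[OF False]
  proof (rule the_equality)
    show "\<forall>g\<in>minimal_paths E K a b. is_arg_max E (\<lambda>x. x \<in> set g) z"
    proof
      fix g' assume g': "g' \<in> minimal_paths E K a b"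
      then obtain z' where "z' \<in> set g'" "E z' = peak g'" using ex[OF ne] by blast
      moreover then have "z' = z" using lev[OF g'] z inj_E by (metis injD)
      ultimately show "is_arg_max E (\<lambda>x. x \<in> set g') z" using * ne[OF g'] by simp
    qed
  next
    fix z' assume "\<forall>g\<in>minimal_paths E K a b. is_arg_max E (\<lambda>x. x \<in> set g) z'"
    then have "E z' = peak g" using g * ne by blast
    then show "z' = z" using z inj_E by (metis injD)
  qed
  then show ?thesis using z by simp
qed

lemma peak_le_iff: "g \<noteq> [] \<Longrightarrow> peak g \<le> h \<longleftrightarrow> set g \<subseteq> {x. E x \<le> h}"
  unfolding peak_def by (subst Max_le_iff) auto

abbreviation below :: "real \<Rightarrow> 's set" where "below h \<equiv> {x. E x \<le> h}"

lemma joined_below_iff: "joined K (below h) a b \<longleftrightarrow> height a b \<le> h"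
proof -
  obtain g where g: "g \<in> minimal_paths E K a b" using minimal_path_exists by blast
  have ne: "g' \<noteq> []" if "g' \<in> sa_paths K a b" for g' using that by (simp add: sa_paths_def)
  have "joined K (below h) a b \<longleftrightarrow> (\<exists>g'\<in>sa_paths K a b. peak g' \<le> h)"
    unfolding joined_iff_sa_path using peak_le_iff ne by blast
  also have "\<dots> \<longleftrightarrow> peak g \<le> h" using g unfolding minimal_paths_iff by (meson order_trans)
  finally show ?thesis using height_minimal_path[OF g] by simp
qed

lemma minimal_paths_eq:
  "minimal_paths E K a b = {g \<in> sa_paths K a b. set g \<subseteq> below (height a b)}"
proof -
  obtain g0 where g0: "g0 \<in> minimal_paths E K a b" using minimal_path_exists by blast
  have h: "height a b = peak g0" using height_minimal_path[OF g0] .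
  have least: "peak g0 \<le> peak g'" "g' \<noteq> []" if "g' \<in> sa_paths K a b" for g'
    using g0 that by (auto simp: minimal_paths_iff sa_paths_def)
  have iff: "g \<in> minimal_paths E K a b \<longleftrightarrow> peak g \<le> peak g0" if g: "g \<in> sa_paths K a b" for g
  proof
    assume "peak g \<le> peak g0"
    then show "g \<in> minimal_paths E K a b"
      unfolding minimal_paths_iff using least(1) g by (meson order_trans)
  next
    assume "g \<in> minimal_paths E K a b"
    then show "peak g \<le> peak g0" using g0 by (simp add: minimal_paths_iff)
  qed
  show ?thesis
  proof (rule set_eqI)
    fix g
    show "g \<in> minimal_paths E K a b \<longleftrightarrow> g \<in> {g \<in> sa_paths K a b. set g \<subseteq> below (height a b)}"
    proof (cases "g \<in> sa_paths K a b")
      case True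
      show ?thesis
        unfolding h iff[OF True] peak_le_iff[OF least(2)[OF True]] using True by simp
    next
      case False
      then show ?thesis by (simp add: minimal_paths_iff)
    qed
  qed
qed

text \<open>
  Turns the clause on minimal paths in the definition of attraction into a statement on
  connectivity.
\<close>

lemma minimal_paths_avoid_iff:
  "(\<forall>g\<in>minimal_paths E K a b. set g \<inter> U \<noteq> {}) \<longleftrightarrow> \<not> joined K (below (height a b) - U) a b"
proof -
  have "set g \<subseteq> below (height a b) - U \<longleftrightarrow> set g \<subseteq> below (height a b) \<and> set g \<inter> U = {}" for g :: "'s list"
    by blast
  then show ?thesis unfolding joined_iff_sa_path minimal_paths_eq by auto
qed

lemma height_self: "height a a = E a"
  by (simp add: essential_saddle_def)

lemma height_le: "joined K (below h) a b \<Longrightarrow> height a b \<le> h"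
  using joined_below_iff by blast

lemma joined_below: "height a b \<le> h \<Longrightarrow> joined K (below h) a b"
  using joined_below_iff by blast

lemma height_sym: "height a b = height b a"
  by (rule antisym; rule height_le[OF joined_sym[OF joined_below[OF order_refl]]])

lemma height_ge_left: "E a \<le> height a b"
proof -
  have "a \<in> below (height a b)" by (rule joined_left[OF joined_below]) (rule order_refl)
  then show ?thesis by simp
qed

lemma height_ge_right: "E b \<le> height a b"
  by (subst height_sym) (rule height_ge_left)

lemma height_ultra: "height a b \<le> h \<Longrightarrow> height b c \<le> h \<Longrightarrow> height a c \<le> h"
  by (rule height_le[OF joined_trans[OF joined_below joined_below]])

lemma height_edge: "K a b \<Longrightarrow> height a b \<le> max (E a) (E b)"
  by (intro height_le joined_edge) auto

lemma local_minimum_isolated: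
  assumes "n \<in> local_minima E K" "y \<noteq> n"
  shows "E n < height n y"
proof (rule ccontr)
  assume "\<not> ?thesis"
  then have "joined K (below (E n)) n y" by (intro joined_below) simp
  then have "y = n"
  proof (induction rule: joined_induct)
    case (step b c)
    then have "K c n" "E c \<le> E n" using K_sym by auto
    then show ?case using assms(1) unfolding local_minima_def neighbour_def by force
  qed simp
  then show False using assms by simp
qed

text \<open>
  The lowest state of the component of \<open>s\<close> in the sublevel set of \<open>E s\<close> is a local minimum.
\<close>

lemma downhill_to_local_minimum:
  obtains n where "n \<in> local_minima E K" "height s n \<le> E s"
proof -
  define C where "C = {v. height s v \<le> E s}"
  have "C \<noteq> {}" by (auto simp: C_def intro!: exI[of _ s] height_self[THEN eq_refl])
  then obtain n where n: "n \<in> C" "\<And>v. v \<in> C \<Longrightarrow> E n \<le> E v"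
    using arg_min_if_finite(1)[of C E] arg_min_least[of C _ E] by auto
  have "E n < E r" if "neighbour K r n" for r
  proof (rule ccontr)
    assume *: "\<not> ?thesis"
    have "K n r" using that K_sym by (simp add: neighbour_def)
    then have "height n r \<le> E n" using * height_edge[of n r] by simp
    moreover have "E n \<le> E s"
      using n(1) height_ge_right[of n s] by (simp add: C_def)
    ultimately have "r \<in> C" using n(1) height_ultra[of s n "E s" r] by (simp add: C_def)
    then have "E r = E n" using n(2)[of r] * by simp
    then show False using that inj_E by (auto simp: neighbour_def dest: injD)
  qed
  then show ?thesis using n that by (auto simp: local_minima_def C_def)
qed

lemma energy_gap:
  obtains \<delta> where "0 < \<delta>" "\<And>a b. E a < E b \<Longrightarrow> E a + \<delta> \<le> E b"
proof -
  (* The extra element keeps the set nonempty when there is only one energy. *)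
  define S where "S = insert 1 {E b - E a | a b. E a < E b}"
  have "{E b - E a | a b. E a < E b} \<subseteq> (\<lambda>(a, b). E b - E a) ` UNIV" by auto
  then have fin: "finite S" unfolding S_def using finite_surj[of UNIV] by (simp add: finite_subset)
  have "0 < Min S" using fin by (subst Min_gr_iff) (auto simp: S_def)
  moreover have "E a + Min S \<le> E b" if "E a < E b" for a b
  proof -
    have "Min S \<le> E b - E a" using fin that by (intro Min_le) (auto simp: S_def)
    then show ?thesis by simp
  qed
  ultimately show ?thesis using that by blast
qed

end

section \<open>Attraction to the members of a set of local minima\<close>

context energy_landscape
begin

definition strict_basin :: "'s set \<Rightarrow> 's \<Rightarrow> 's set" where
  "strict_basin M x = {s. \<forall>y\<in>M - {x}. height s x < height s y}"

text \<open>
  Attraction at one level, with the metastable states of that level replaced by an arbitrary set.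
\<close>

definition attracted_among :: "'s set \<Rightarrow> 's \<Rightarrow> 's \<Rightarrow> bool" where
  "attracted_among M s x \<longleftrightarrow> x \<in> M \<and> (\<forall>y\<in>M. height s x \<le> height s y) \<and>
     (\<forall>y\<in>M - {x}. \<not> joined K (below (height s x) - strict_basin M x) s y)"

lemma attracted_amongD:
  assumes "attracted_among M s x"
  shows "x \<in> M" "\<And>y. y \<in> M \<Longrightarrow> height s x \<le> height s y"
    "\<And>y. y \<in> M \<Longrightarrow> y \<noteq> x \<Longrightarrow> \<not> joined K (below (height s x) - strict_basin M x) s y"
  using assms by (auto simp: attracted_among_def)

lemma strict_basinD: "u \<in> strict_basin M x \<Longrightarrow> y \<in> M \<Longrightarrow> y \<noteq> x \<Longrightarrow> height u x < height u y"
  by (simp add: strict_basin_def)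

lemma strict_basin_antimono: "M' \<subseteq> M \<Longrightarrow> strict_basin M x \<subseteq> strict_basin M' x"
  by (auto simp: strict_basin_def)

lemma local_minimum_in_strict_basin:
  assumes "M \<subseteq> local_minima E K" "n \<in> M" shows "n \<in> strict_basin M n"
proof -
  have "height n n < height n y" if "y \<in> M - {n}" for y
    using local_minimum_isolated[of n y] assms that by (auto simp: height_self)
  then show ?thesis by (simp add: strict_basin_def)
qed

text \<open>
  A strict basin is a union of components of sublevel sets: going from \<open>u\<close> to \<open>v\<close> costs no more
  than going from \<open>u\<close> to \<open>n\<close>, so by the ultrametric inequality a minimum as close to \<open>v\<close> as \<open>n\<close>
  would be as close to \<open>u\<close>.
\<close>

lemma strict_basin_closed:
  assumes "u \<in> strict_basin M n" "height u v \<le> height u n"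
  shows "v \<in> strict_basin M n"
proof -
  have "height v n < height v y" if y: "y \<in> M" "y \<noteq> n" for y
  proof (rule ccontr)
    assume *: "\<not> ?thesis"
    have "height v n \<le> height u n" using height_ultra[of v u "height u n" n] assms(2) height_sym by simp
    then have "height u y \<le> height u n" using * height_ultra[of u v "height u n" y] assms(2) by simp
    then show False using strict_basinD[OF assms(1) y] by simp
  qed
  then show ?thesis by (simp add: strict_basin_def)
qed

lemma strict_basin_path:
  assumes "u \<in> strict_basin M n" "height u n \<le> h"
  shows "joined K (below h \<inter> strict_basin M n) u n"
proof (rule joined_stays)
  show "joined K (below (height u n)) u n" by (rule joined_below) simp
  fix v assume v: "joined K (below (height u n)) u v"
  then have "v \<in> strict_basin M n" using strict_basin_closed[OF assms(1)] height_le by blast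
  then show "v \<in> below h \<inter> strict_basin M n" using joined_right[OF v] assms(2) by simp
qed

text \<open>
  The minimality of \<open>height s x\<close> comes for free: a cheaper connection to some \<open>y\<close> would enter the
  strict basin of \<open>x\<close>, from where \<open>x\<close> is cheaper still. The slack in \<open>h\<close> allows applications where
  only an upper bound for \<open>height s x\<close> is at hand.
\<close>

lemma attracted_amongI:
  assumes "x \<in> M" "height s x \<le> h"
    and no: "\<And>y. y \<in> M \<Longrightarrow> y \<noteq> x \<Longrightarrow> \<not> joined K (below h - strict_basin M x) s y"
  shows "attracted_among M s x"
proof -
  have "height s x \<le> height s y" if y: "y \<in> M" for y
  proof (rule ccontr)
    assume *: "\<not> ?thesis"
    then have "y \<noteq> x" by auto
    have "\<not> joined K (below (height s y) - strict_basin M x) s y"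
    proof
      assume "joined K (below (height s y) - strict_basin M x) s y"
      then have "joined K (below h - strict_basin M x) s y"
        by (rule joined_mono) (use * assms(2) in auto)
      then show False using no[OF y \<open>y \<noteq> x\<close>] by simp
    qed
    then obtain u where u: "u \<in> strict_basin M x" "joined K (below (height s y)) s u" "joined K (below (height s y)) u y"
      using joined_through[OF joined_below[OF order_refl]] by metis
    have "height u x \<le> height s y"
      using strict_basinD[OF u(1) y \<open>y \<noteq> x\<close>] height_le[OF u(3)] by simp
    then have "height s x \<le> height s y" using height_le[OF u(2)] height_ultra by blast
    then show False using * by simp
  qed
  moreover have "\<not> joined K (below (height s x) - strict_basin M x) s y" if "y \<in> M - {x}" for y
  proof
    assume "joined K (below (height s x) - strict_basin M x) s y"
    then have "joined K (below h - strict_basin M x) s y"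
      by (rule joined_mono) (use assms(2) in auto)
    then show False using no that by simp
  qed
  ultimately show ?thesis using assms(1) by (simp add: attracted_among_def)
qed

lemma strict_basin_attracted:
  assumes "u \<in> strict_basin M x" "x \<in> M" shows "attracted_among M u x"
proof (rule attracted_amongI[OF assms(2) order_refl])
  fix y show "\<not> joined K (below (height u x) - strict_basin M x) u y"
    using assms(1) joined_left by fastforce
qed

text \<open>
  As long as the strict basin of \<open>n\<close> is not entered, every connection from \<open>t\<close> to another minimum
  extends a connection from \<open>s\<close>, so that the obstruction for \<open>s\<close> persists.
\<close>

lemma attracted_among_component:
  assumes "attracted_among M s n" "joined K (below (height s n) - strict_basin M n) s t"
  shows "attracted_among M t n"
proof (rule attracted_amongI)
  have "joined K (below (height s n)) t s"
    by (rule joined_sym, rule joined_mono[OF assms(2)]) auto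
  then show "height t n \<le> height s n"
    using height_le height_ultra[of t s "height s n" n] by simp
  show "n \<in> M" using attracted_amongD(1)[OF assms(1)] .
  fix y assume "y \<in> M" "y \<noteq> n"
  then show "\<not> joined K (below (height s n) - strict_basin M n) t y"
    using attracted_amongD(3)[OF assms(1)] joined_trans[OF assms(2)] by metis
qed

lemma attracted_among_edge:
  assumes "attracted_among M s n" "K s t" "E t \<le> height s n"
  shows "attracted_among M t n"
proof (cases "s \<in> strict_basin M n \<or> t \<in> strict_basin M n")
  case True
  have "height s t \<le> height s n"
    using height_edge[OF assms(2)] height_ge_left[of s n] assms(3) by simp
  then have "t \<in> strict_basin M n" using True strict_basin_closed by blast
  then show ?thesis using strict_basin_attracted attracted_amongD(1)[OF assms(1)] by simp
next
  case False
  then have "joined K (below (height s n) - strict_basin M n) s t"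
    using assms height_ge_left[of s n] by (intro joined_edge) auto
  then show ?thesis using attracted_among_component[OF assms(1)] by simp
qed

text \<open>
  A walk to \<open>n\<close> must meet \<open>U\<close>, but it enters \<open>strict_basin M n\<close> no later than at \<open>n\<close>, and from
  the entrance on it can be continued inside that basin, which is disjoint from \<open>U\<close>. So \<open>U\<close> is met
  before.
\<close>

lemma reach_first:
  assumes "height t n \<le> h" "n \<in> strict_basin M n" "\<not> joined K (below h - U) t n" "U \<inter> strict_basin M n = {}"
  obtains u where "u \<in> U" "joined K (below h - strict_basin M n) t u"
proof (rule ccontr)
  assume "\<not> thesis"
  then have noU: "v \<notin> U" if "joined K (below h - strict_basin M n) t v" for v
    using that \<open>\<And>u. u \<in> U \<Longrightarrow> joined K (below h - strict_basin M n) t u \<Longrightarrow> thesis\<close> by auto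
  have "\<not> joined K (below h - strict_basin M n) t n" using joined_right assms(2) by fastforce
  then obtain u where u: "u \<in> strict_basin M n" "joined K (below h) u n"
      "u = t \<or> (\<exists>v. joined K (below h - strict_basin M n) t v \<and> K v u)"
    using joined_first_visit[OF joined_below[OF assms(1)], of "strict_basin M n"] by auto
  have un: "joined K (below h - U) u n"
    by (rule joined_mono[OF strict_basin_path[OF u(1) height_le[OF u(2)]]]) (use assms(4) in auto)
  have "joined K (below h - U) t u"
  proof (cases "u = t")
    case True
    then show ?thesis using joined_left[OF un] by simp
  next
    case False
    then obtain v where v: "joined K (below h - strict_basin M n) t v" "K v u" using u(3) by auto
    have "joined K (below h - U) t v"
    proof (rule joined_stays[OF v(1)])
      fix w assume w: "joined K (below h - strict_basin M n) t w"
      then show "w \<in> below h - U" using noU joined_right[OF w] by auto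
    qed
    then show ?thesis using v(2) joined_left[OF un] by (rule joined_step)
  qed
  then show False using assms(3) joined_trans[OF _ un] by simp
qed

text \<open>
  The consistency of attraction at different levels. Suppose \<open>a\<close> could bypass the basin of \<open>n\<close> on
  the way to some \<open>y\<close>. It suffices to lead \<open>t\<close> to \<open>a\<close> outside this basin, because then \<open>t\<close>
  reaches \<open>y\<close> outside it as well. If \<open>a\<close> is strictly cheaper for \<open>t\<close> than \<open>n\<close>, no state on the way
  to \<open>a\<close> can be in the basin of \<open>n\<close>. If \<open>a\<close> and \<open>n\<close> cost the same, the attraction by \<open>a\<close> forces
  \<open>t\<close> to pass the basin of \<open>a\<close>, which is disjoint from the basin of \<open>n\<close>.
\<close>

lemma attracted_among_forward:
  assumes a: "attracted_among M' t a" and n: "attracted_among M t n" and "M \<subseteq> M'" "M' \<subseteq> local_minima E K" "a \<noteq> n"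
  shows "attracted_among M a n"
proof (rule attracted_amongI[OF _ order_refl])
  show nM: "n \<in> M" using attracted_amongD(1)[OF n] .
  have nM': "n \<in> M'" using nM assms(3) by auto
  have nsv: "n \<in> strict_basin M n" using local_minimum_in_strict_basin[of M n] nM assms by auto
  fix y assume y: "y \<in> M" "y \<noteq> n"
  show "\<not> joined K (below (height a n) - strict_basin M n) a y"
  proof
    assume ay: "joined K (below (height a n) - strict_basin M n) a y"
    define h where "h = height t n"
    have ta: "height t a \<le> h" using attracted_amongD(2)[OF a nM'] by (simp add: h_def)
    have an: "height a n \<le> h" using height_ultra[of a t h n] ta height_sym by (simp add: h_def)
    have ayh: "joined K (below h - strict_basin M n) a y"
      by (rule joined_mono[OF ay]) (use an in auto)
    have "joined K (below (height a n)) a y" by (rule joined_mono[OF ay]) auto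
    then have ayn: "height a y \<le> height a n" by (rule height_le)
    have a_notin: "a \<notin> strict_basin M n" using joined_left[OF ay] by simp
    (* The whole proof rests on this connection; continued by the one from a to y it contradicts
       the attraction of t by n. *)
    have "joined K (below h - strict_basin M n) t a"
    proof (cases "height t a < h")
      case True
      show ?thesis
      proof (rule joined_stays[OF joined_below[OF order_refl]])
        fix v assume v: "joined K (below (height t a)) t v"
        have tv: "height t v \<le> height t a" using height_le[OF v] .
        have "v \<notin> strict_basin M n"
        proof
          assume "v \<in> strict_basin M n"
          then have "height v n < height v y" using strict_basinD y by simp
          moreover have "height t y \<le> h" using height_ultra[OF ta] ayn an by simp
          then have "height v y \<le> h" using height_ultra[of v t h y] tv ta height_sym by simp
          ultimately have "height v n < h" by simp
          then have "height t n \<le> max (height t a) (height v n)"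
            using height_ultra[of t v _ n] tv by simp
          then show False using True \<open>height v n < h\<close> by (simp add: h_def)
        qed
        then show "v \<in> below h - strict_basin M n" using joined_right[OF v] ta by simp
      qed
    next
      case False
      then have hta: "h = height t a" using ta by simp
      have disj: "strict_basin M' a \<inter> strict_basin M n = {}"
      proof (rule ccontr)
        assume "\<not> ?thesis"
        then obtain w where w: "w \<in> strict_basin M' a" "w \<in> strict_basin M n" by auto
        have wa: "height w a < height w n" using strict_basinD[OF w(1) nM'] assms(5) by simp
        have "height w n < height w y" using strict_basinD[OF w(2)] y by simp
        moreover have "height a n \<le> height w n"
          using height_ultra[of a w "height w n" n] wa height_sym by simp
        then have "height w y \<le> height w n"
          using height_ultra[of w a "height w n" y] wa ayn by simp
        ultimately show False by simp
      qed
      have "\<not> joined K (below h - strict_basin M' a) t n"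
        using attracted_amongD(3)[OF a nM'] assms(5) hta by simp
      then obtain u where u: "u \<in> strict_basin M' a" "joined K (below h - strict_basin M n) t u"
        using reach_first[of t n h M "strict_basin M' a"] nsv disj by (auto simp: h_def)
      have "joined K (below h) u t" by (rule joined_sym, rule joined_mono[OF u(2)]) auto
      then have "height u a \<le> h" using height_ultra[OF height_le] ta by simp
      then have "joined K (below h - strict_basin M n) u a"
        by (intro joined_mono[OF strict_basin_path[OF u(1)]]) (use disj in auto)
      then show ?thesis by (rule joined_trans[OF u(2)])
    qed
    then have "joined K (below h - strict_basin M n) t y" using ayh by (rule joined_trans)
    then show False using attracted_amongD(3)[OF n] y by (simp add: h_def)
  qed
qed

text \<open>
  If \<open>a\<close> were attracted by \<open>n\<close>, it would be at least as close to \<open>n\<close> as to itself, although it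
  is a strict local minimum.
\<close>

lemma attracted_among_unique:
  assumes "attracted_among M' t a" "attracted_among M t n" "M \<subseteq> M'" "M' \<subseteq> local_minima E K" "a \<in> M"
  shows "a = n"
proof (rule ccontr)
  assume ne: "a \<noteq> n"
  then have "attracted_among M a n" by (rule attracted_among_forward[OF assms(1-4)])
  then have "height a n \<le> E a" using attracted_amongD(2)[of M a n a] assms(5) by (simp add: height_self)
  moreover have "E a < height a n" using local_minimum_isolated[of a n] ne assms by auto
  ultimately show False by simp
qed

end

section \<open>Valleys and mergers\<close>

locale ranked_landscape = energy_landscape E K for E :: "'s::finite \<Rightarrow> real" and K +
  fixes m :: "nat \<Rightarrow> 's"
  assumes meta: "meta_enumeration E K m"
begin

abbreviation M :: "nat \<Rightarrow> 's set" where "M \<equiv> meta_states E K m"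
abbreviation nn :: nat where "nn \<equiv> n_meta E K"
abbreviation V :: "nat \<Rightarrow> 's \<Rightarrow> 's set" where "V \<equiv> valley E K m"
abbreviation N :: "nat \<Rightarrow> 's set" where "N \<equiv> non_assigned E K m"

lemma M_Suc: "1 \<le> k \<Longrightarrow> M (Suc k) = M k - {m k}"
  by (cases k) auto

lemma M_antimono: assumes "1 \<le> k" "k \<le> l" shows "M l \<subseteq> M k"
  using assms(2,1)
proof (induction rule: dec_induct)
  case (step l)
  then show ?case using M_Suc[of l] by auto
qed simp

lemma M_local_minima: "1 \<le> k \<Longrightarrow> M k \<subseteq> local_minima E K"
  using M_antimono[of 1 k] by simp

lemma m_in_M: "1 \<le> k \<Longrightarrow> k \<le> nn \<Longrightarrow> m k \<in> M k"
  using meta unfolding meta_enumeration_def is_arg_min_def by (cases "k = nn") auto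

lemma card_M: "1 \<le> k \<Longrightarrow> k \<le> nn \<Longrightarrow> card (M k) = nn - k + 1"
proof (induction k rule: dec_induct)
  case base
  then show ?case by (simp add: n_meta_def)
next
  case (step k)
  then show ?case using M_Suc[of k] m_in_M[of k] by (simp add: card_Diff_singleton)
qed

lemma M_eq: "1 \<le> k \<Longrightarrow> k \<le> nn \<Longrightarrow> M k = m ` {k..nn}"
proof (induction "nn - k" arbitrary: k)
  case 0
  then have "k = nn" by simp
  have "card (M nn) = 1" using card_M[of nn] 0 by simp
  then obtain y where "M nn = {y}" by (auto simp: card_1_singleton_iff)
  then show ?case using m_in_M[of nn] 0 \<open>k = nn\<close> by simp
next
  case (Suc d)
  then have "M (Suc k) = m ` {Suc k..nn}" by simp
  then have "M k = insert (m k) (m ` {Suc k..nn})"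
    using M_Suc[of k] m_in_M[of k] Suc by auto
  moreover have "{k..nn} = insert k {Suc k..nn}" using Suc by auto
  ultimately show ?case by simp
qed

lemma m_neq: "1 \<le> j \<Longrightarrow> j < k \<Longrightarrow> k \<le> nn \<Longrightarrow> m j \<noteq> m k"
  using M_Suc[of j] M_antimono[of "Suc j" k] m_in_M[of k] by auto

lemma m_inj: "1 \<le> j \<Longrightarrow> j \<le> nn \<Longrightarrow> 1 \<le> k \<Longrightarrow> k \<le> nn \<Longrightarrow> m j = m k \<Longrightarrow> j = k"
  using m_neq by (metis nat_neq_iff)

lemma M_E:
  assumes "1 \<le> k" "k \<le> nn" "x \<in> M k"
  obtains j where "k \<le> j" "j \<le> nn" "x = m j"
  using M_eq[OF assms(1,2)] assms(3) by auto

lemma attracted_iff: "attracted E K m k s x \<longleftrightarrow> attracted_among (M k) s x"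
proof (cases "x \<in> M k")
  case True
  have fin: "finite ((\<lambda>n. height s n) ` M k)" by simp
  have min: "height s x = Min ((\<lambda>n. height s n) ` M k) \<longleftrightarrow> (\<forall>y\<in>M k. height s x \<le> height s y)"
    using True by (subst eq_commute, subst Min_eq_iff) auto
  have strict_basin: "strict_valley E K m k x = strict_basin (M k) x"
    by (simp add: strict_valley_def strict_basin_def)
  have path: "(height s y = height s x \<longrightarrow>
        (\<forall>g\<in>minimal_paths E K s y. set g \<inter> strict_basin (M k) x \<noteq> {})) \<longleftrightarrow>
      \<not> joined K (below (height s x) - strict_basin (M k) x) s y" if "height s x \<le> height s y" for y
  proof (cases "height s y = height s x")
    case True
    show ?thesis unfolding minimal_paths_avoid_iff using True by simp
  next
    case False
    have "\<not> joined K (below (height s x) - strict_basin (M k) x) s y"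
    proof
      assume "joined K (below (height s x) - strict_basin (M k) x) s y"
      then have "joined K (below (height s x)) s y" by (rule joined_mono) auto
      then show False using height_le False that by fastforce
    qed
    then show ?thesis using False by simp
  qed
  show ?thesis unfolding attracted_def attracted_among_def min strict_basin using path by auto
qed (simp add: attracted_def attracted_among_def)

lemma merge_level_E:
  assumes "merge_level E K m b = enat l"
  shows "b < l" "l \<le> nn" "\<exists>x\<in>M l. attracted_among (M l) (m b) x"
proof -
  define S where "S = {enat j | j. b < j \<and> j \<le> nn \<and> (\<exists>x\<in>M j. attracted E K m j (m b) x)}"
  have eq: "Inf S = enat l" using assms by (simp add: merge_level_def S_def)
  then have "S \<noteq> {}" by (auto simp: Inf_enat_def)
  then have "Inf S \<in> S" unfolding Inf_enat_def using LeastI[of "\<lambda>x. x \<in> S"] by auto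
  then have "enat l \<in> S" using eq by simp
  then show "b < l" "l \<le> nn" "\<exists>x\<in>M l. attracted_among (M l) (m b) x"
    by (auto simp: S_def attracted_iff)
qed

lemma merge_level_exists:
  assumes "b < q" "q \<le> nn" "attracted_among (M q) (m b) x"
  obtains l where "merge_level E K m b = enat l" "l \<le> q"
proof -
  have "merge_level E K m b \<le> enat q"
    unfolding merge_level_def using assms attracted_amongD(1)[OF assms(3)]
    by (intro Inf_lower) (auto simp: attracted_iff)
  then show ?thesis using that by (cases "merge_level E K m b") auto
qed

text \<open>
  The valley of the \<open>b\<close>-th minimum is merged into that of the \<open>c\<close>-th one at a level \<open>\<le> k\<close>.
\<close>

definition parent :: "nat \<Rightarrow> nat \<Rightarrow> nat \<Rightarrow> bool" where
  "parent k b c \<longleftrightarrow> 1 \<le> b \<and> c \<le> nn \<and>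
     (\<exists>l. merge_level E K m b = enat l \<and> l \<le> k \<and> l \<le> c \<and> attracted_among (M l) (m b) (m c))"

lemma parentE:
  assumes "parent k b c"
  obtains l where "merge_level E K m b = enat l" "1 \<le> b" "b < l" "l \<le> k" "l \<le> c" "c \<le> nn"
    "attracted_among (M l) (m b) (m c)"
  using assms merge_level_E(1) unfolding parent_def by blast

lemma parent_exists:
  assumes "1 \<le> b" "b < q" "q \<le> nn" "attracted_among (M q) (m b) x"
  obtains c where "parent q b c" "b < c"
proof -
  obtain l where l: "merge_level E K m b = enat l" "l \<le> q"
    using merge_level_exists[OF assms(2-4)] by blast
  obtain y where y: "y \<in> M l" "attracted_among (M l) (m b) y" using merge_level_E(3)[OF l(1)] by blast
  have bl: "b < l" "l \<le> nn" using merge_level_E[OF l(1)] by auto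
  obtain c where c: "l \<le> c" "c \<le> nn" "y = m c" using M_E[of l y] bl y(1) assms(1) by auto
  show ?thesis using that[of c] c l y bl assms(1) unfolding parent_def by auto
qed

lemma parent_mono: "parent k b c \<Longrightarrow> k \<le> k' \<Longrightarrow> parent k' b c"
  unfolding parent_def using order_trans by blast

lemma parent_less: "parent k b c \<Longrightarrow> b < k"
  by (elim parentE) simp

lemma parent_functional:
  assumes "parent k b c" "parent k b d" shows "c = d"
proof -
  obtain l where l: "merge_level E K m b = enat l" "1 \<le> b" "b < l" "l \<le> c" "c \<le> nn"
      "attracted_among (M l) (m b) (m c)" using assms(1) by (rule parentE)
  obtain l' where l': "merge_level E K m b = enat l'" "l' \<le> d" "d \<le> nn"
      "attracted_among (M l') (m b) (m d)" using assms(2) by (rule parentE)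
  have "l' = l" using l l' by simp
  then have "m c = m d"
    using attracted_among_unique[of "M l" "m b" "m c" "M l" "m d"] l l' attracted_amongD(1) M_local_minima[of l] by auto
  then show ?thesis using m_inj[of c d] l l' \<open>l' = l\<close> by simp
qed

lemma parent_chain_mono: "(parent k)\<^sup>*\<^sup>* b c \<Longrightarrow> k \<le> k' \<Longrightarrow> (parent k')\<^sup>*\<^sup>* b c"
  using rtranclp_mono[of "parent k" "parent k'"] parent_mono by blast

lemma parent_chain_end:
  assumes "(parent k)\<^sup>*\<^sup>* b c" "k \<le> b" shows "c = b"
  using assms(1)
proof (cases rule: converse_rtranclpE)
  case (step y)
  then show ?thesis using parent_less assms(2) by force
qed simp

lemma parent_chain_linear:
  assumes "(parent k)\<^sup>*\<^sup>* b c" "(parent k)\<^sup>*\<^sup>* b j" "k \<le> j"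
  shows "(parent k)\<^sup>*\<^sup>* c j"
  using assms(1)
proof (induction rule: rtranclp_induct)
  case base
  then show ?case using assms(2) .
next
  case (step c d)
  from step.IH show ?case
  proof (cases rule: converse_rtranclpE)
    case base
    then show ?thesis using parent_less[OF step.hyps(2)] assms(3) by simp
  next
    case (step y)
    then show ?thesis using parent_functional \<open>parent k c d\<close> by blast
  qed
qed

lemma valley_one: "V 1 x = {s. attracted_among (M 1) s x}"
  by (simp add: attracted_iff)

lemma valley_step: "1 \<le> k \<Longrightarrow> V (Suc k) x = V k x \<union> {s \<in> N k. attracted_among (M (Suc k)) s x} \<union>
     (\<Union>j\<in>{j. 1 \<le> j \<and> j < Suc k \<and> merge_level E K m j = enat (Suc k) \<and> attracted_among (M (Suc k)) (m j) x}. V j (m j))"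
  by (cases k) (simp_all add: attracted_iff)

declare valley.simps [simp del] non_assigned.simps [simp del]

lemma V_mono: assumes "1 \<le> k" "k \<le> l" shows "V k x \<subseteq> V l x"
  using assms(2,1)
proof (induction rule: dec_induct)
  case (step l)
  then show ?case using valley_step[of l x] by auto
qed simp

lemma N_iff: "s \<in> N k \<longleftrightarrow> (\<forall>j\<in>{1..nn}. s \<notin> V (min k j) (m j))"
  by (simp add: non_assigned.simps)

lemma not_N_E:
  assumes "s \<notin> N k" "1 \<le> k"
  obtains j where "1 \<le> j" "j \<le> nn" "s \<in> V (min k j) (m j)"
  using assms by (auto simp: N_iff)

lemma V_not_N: "s \<in> V q (m b) \<Longrightarrow> 1 \<le> q \<Longrightarrow> q \<le> k \<Longrightarrow> q \<le> b \<Longrightarrow> b \<le> nn \<Longrightarrow> s \<notin> N k"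
  using V_mono[of q "min k b" "m b"] by (auto simp: N_iff)

lemma N_antimono: "1 \<le> k \<Longrightarrow> k \<le> l \<Longrightarrow> N l \<subseteq> N k"
proof
  fix s assume *: "1 \<le> k" "k \<le> l" "s \<in> N l"
  show "s \<in> N k"
  proof (rule ccontr)
    assume "s \<notin> N k"
    then obtain j where j: "1 \<le> j" "j \<le> nn" "s \<in> V (min k j) (m j)" using * by (auto elim: not_N_E)
    then have "s \<notin> N l" using V_not_N[of s "min k j" j l] * by (simp add: min.coboundedI1)
    then show False using * by simp
  qed
qed

text \<open>
  The clause \<open>k = 1\<close> replaces the convention that all states are non-assigned at level 0.
\<close>

definition first_attraction :: "'s \<Rightarrow> nat \<Rightarrow> nat \<Rightarrow> bool" where
  "first_attraction s k b \<longleftrightarrow> 1 \<le> k \<and> k \<le> b \<and> b \<le> nn \<and> attracted_among (M k) s (m b) \<and> (k = 1 \<or> s \<in> N (k - 1))"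

lemma first_attractionD:
  assumes "first_attraction s k b"
  shows "1 \<le> k" "k \<le> b" "b \<le> nn" "attracted_among (M k) s (m b)" "k = 1 \<or> s \<in> N (k - 1)"
  using assms by (auto simp: first_attraction_def)

lemma first_attraction_V: "first_attraction s k b \<Longrightarrow> s \<in> V k (m b)"
proof -
  assume f: "first_attraction s k b"
  show ?thesis
  proof (cases "k = 1")
    case True
    then show ?thesis using first_attractionD[OF f] valley_one[of "m b"] by simp
  next
    case False
    then obtain k' where "k = Suc k'" "1 \<le> k'" using first_attractionD(1)[OF f] by (cases k) auto
    then show ?thesis using first_attractionD[OF f] valley_step[of k' "m b"] by auto
  qed
qed

text \<open>
  A non-assigned state of level \<open>k\<close> was non-assigned one level earlier, hence would have been added
  to the valley of \<open>x\<close> at level \<open>k\<close>.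
\<close>

lemma attracted_among_not_N:
  assumes "attracted_among (M k) s x" "1 \<le> k" "k \<le> nn" shows "s \<notin> N k"
proof
  assume s: "s \<in> N k"
  obtain b where b: "k \<le> b" "b \<le> nn" "x = m b" using M_E[OF assms(2,3) attracted_amongD(1)[OF assms(1)]] by blast
  have "k = 1 \<or> s \<in> N (k - 1)" 
  proof (cases "k = 1")
    case False
    then have "1 \<le> k - 1" using assms(2) by linarith
    then show ?thesis using N_antimono[of "k - 1" k] s by auto
  qed simp
  then have "first_attraction s k b" using assms b by (simp add: first_attraction_def)
  then show False using V_not_N[OF first_attraction_V] s b assms by blast
qed

lemma first_attraction_unique:
  assumes "first_attraction s k b" "first_attraction s k' b'" shows "k = k' \<and> b = b'"
proof -
  have no: "\<not> k < k'" if "first_attraction s k b" "first_attraction s k' b'" for k b k' b'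
  proof
    assume "k < k'"
    then have "s \<in> N (k' - 1)" using first_attractionD[OF that(2)] first_attractionD[OF that(1)] by auto
    moreover have "k \<le> k' - 1" using \<open>k < k'\<close> by linarith
    ultimately have "s \<in> N k" using N_antimono[of k "k' - 1"] first_attractionD(1)[OF that(1)] by auto
    then show False using V_not_N[OF first_attraction_V[OF that(1)]] first_attractionD[OF that(1)] by auto
  qed
  then have k: "k = k'" using assms by (metis linorder_neqE_nat)
  note f = first_attractionD[OF assms(1)] and f' = first_attractionD[OF assms(2)]
  have "m b = m b'"
    using attracted_among_unique[OF f(4) f'(4)] k attracted_amongD(1)[OF f(4)] M_local_minima[OF f(1)] by simp
  then show ?thesis using m_inj[of b b'] f f' k by simp
qed

text \<open>
  Unfolds the recursive definition of valleys: the first attraction of \<open>s\<close> is to some \<open>b\<close>, and the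
  valley of \<open>b\<close> reaches \<open>j\<close> by mergers up to level \<open>k\<close>.
\<close>

lemma valley_chain:
  assumes "1 \<le> k" "k \<le> j" "j \<le> nn" "s \<in> V k (m j)"
  shows "\<exists>l b. l \<le> k \<and> first_attraction s l b \<and> (parent k)\<^sup>*\<^sup>* b j"
  using assms
proof (induction k arbitrary: s j rule: less_induct)
  case (less k)
  show ?case
  proof (cases "k = 1")
    case True
    then have "first_attraction s 1 j" using less valley_one[of "m j"] by (simp add: first_attraction_def)
    then show ?thesis using True by blast
  next
    case False
    then obtain k' where k': "k = Suc k'" "1 \<le> k'" using less by (cases k) auto
    then consider "s \<in> V k' (m j)" | "s \<in> N k'" "attracted_among (M k) s (m j)"
      | i where "1 \<le> i" "i < k" "merge_level E K m i = enat k" "attracted_among (M k) (m i) (m j)" "s \<in> V i (m i)"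
      using less.prems(4) valley_step[of k' "m j"] by auto
    then show ?thesis
    proof cases
      case 1
      then obtain l b where "l \<le> k'" "first_attraction s l b" "(parent k')\<^sup>*\<^sup>* b j"
        using less.IH[of k' j s] k' less.prems by auto
      then show ?thesis using parent_chain_mono[of k' b j k] k' by (metis le_SucI lessI less_imp_le)
    next
      case 2
      then have "first_attraction s k j" using less.prems k' by (simp add: first_attraction_def)
      then show ?thesis by blast
    next
      case 3
      then obtain l b where lb: "l \<le> i" "first_attraction s l b" "(parent i)\<^sup>*\<^sup>* b i"
        using less.IH[of i i s] less.prems by auto
      have "parent k i j" using 3 less.prems by (auto simp: parent_def)
      then have "(parent k)\<^sup>*\<^sup>* b j"
        using parent_chain_mono[OF lb(3), of k] 3 by (meson less_imp_le rtranclp.rtrancl_into_rtrancl)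
      then show ?thesis using lb 3 by (meson less_imp_le order_trans)
    qed
  qed
qed

lemma V_parent:
  assumes "parent k b c" shows "V b (m b) \<subseteq> V (min c k) (m c)"
proof -
  obtain l where l: "merge_level E K m b = enat l" "1 \<le> b" "b < l" "l \<le> k" "l \<le> c" "c \<le> nn"
      "attracted_among (M l) (m b) (m c)" using assms by (rule parentE)
  obtain l' where l': "l = Suc l'" "1 \<le> l'" using l by (cases l) auto
  then have "V b (m b) \<subseteq> V l (m c)" using valley_step[of l' "m c"] l by auto
  also have "\<dots> \<subseteq> V (min c k) (m c)" using l by (intro V_mono) auto
  finally show ?thesis .
qed

lemma V_chain:
  assumes "(parent k)\<^sup>*\<^sup>* b c" shows "V (min b k) (m b) \<subseteq> V (min c k) (m c)"
  using assms
proof (induction rule: rtranclp_induct)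
  case (step c d)
  have "min c k = c" using parent_less[OF step.hyps(2)] by simp
  then show ?case using V_parent[OF step.hyps(2)] step.IH by simp
qed simp

text \<open>
  If \<open>b\<close> has been removed at level \<open>k\<close>, then \<open>m b\<close> is attracted by \<open>m n\<close>
  as well, hence it has merged into some \<open>c > b\<close> by level \<open>k\<close>. The argument repeats with \<open>m b\<close> in the
  role of \<open>s\<close> and \<open>c\<close> in the role of \<open>b\<close>.
\<close>

lemma attracted_among_chain:
  assumes "attracted_among (M k') s (m b)" "attracted_among (M k) s (m n)" "1 \<le> k'" "k' \<le> k" "k' \<le> b" "b \<le> nn" "k \<le> n" "n \<le> nn"
  shows "(parent k)\<^sup>*\<^sup>* b n"
  using assms
proof (induction "nn - b" arbitrary: b s k' rule: less_induct)
  case less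
  have sub: "M k \<subseteq> M k'" "M k' \<subseteq> local_minima E K"
    using M_antimono[of k' k] M_local_minima[of k'] less.prems by auto
  show ?case
  proof (cases "k \<le> b")
    case True
    then have "m b \<in> M k" using M_eq[of k] less.prems by auto
    then have "m b = m n" using attracted_among_unique[OF less.prems(1,2) sub] by simp
    then show ?thesis using m_inj[of b n] less.prems True by auto
  next
    case False
    then have "m b \<noteq> m n" using m_neq[of b n] less.prems by auto
    then have bn: "attracted_among (M k) (m b) (m n)" by (rule attracted_among_forward[OF less.prems(1,2) sub])
    obtain c where c: "parent k b c" "b < c"
      using parent_exists[OF _ _ _ bn] False less.prems by auto
    obtain l where l: "b < l" "l \<le> k" "l \<le> c" "c \<le> nn" "attracted_among (M l) (m b) (m c)"
      using c(1) by (rule parentE)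
    have "(parent k)\<^sup>*\<^sup>* c n"
      using less.hyps[of c l "m b"] l bn less.prems c by auto
    then show ?thesis using c(1) by (rule converse_rtranclp_into_rtranclp[rotated])
  qed
qed

text \<open>
  Valleys are built from first attractions only; the chain of mergers shows that later attractions
  never contradict them.
\<close>

lemma attracted_among_in_V:
  assumes "attracted_among (M k) t (m b)" "1 \<le> k" "k \<le> b" "b \<le> nn"
  shows "t \<in> V k (m b)"
proof -
  have "t \<notin> N k" using attracted_among_not_N[OF assms(1)] assms by simp
  then obtain j where j: "1 \<le> j" "j \<le> nn" "t \<in> V (min k j) (m j)" using assms by (auto elim: not_N_E)
  then obtain l c where lc: "l \<le> min k j" "first_attraction t l c"
    using valley_chain[of "min k j" j t] assms by auto
  have "(parent k)\<^sup>*\<^sup>* c b"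
    using attracted_among_chain[of l t c k b] first_attractionD[OF lc(2)] assms lc(1) by auto
  then have "V (min c k) (m c) \<subseteq> V k (m b)" using V_chain[of k c b] assms by (simp add: min_absorb2)
  moreover have "V l (m c) \<subseteq> V (min c k) (m c)"
    using first_attractionD[OF lc(2)] lc(1) by (intro V_mono) auto
  ultimately show ?thesis using first_attraction_V[OF lc(2)] by auto
qed

text \<open>
  Both valleys collect the chain of mergers that starts at the first attraction of \<open>u\<close>. The chain is
  deterministic and stops at \<open>j\<close>, because \<open>m j\<close> has not been removed at level \<open>i\<close>. So \<open>b\<close> lies on
  the way to \<open>j\<close>.
\<close>

lemma V_nested:
  assumes "u \<in> V k (m b)" "u \<in> V i (m j)" "1 \<le> k" "k \<le> i" "k \<le> b" "b \<le> nn" "i \<le> j" "j \<le> nn"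
  shows "V k (m b) \<subseteq> V i (m j)"
proof -
  obtain l c where lc: "first_attraction u l c" "(parent k)\<^sup>*\<^sup>* c b"
    using valley_chain[of k b u] assms by auto
  obtain l' c' where lc': "first_attraction u l' c'" "(parent i)\<^sup>*\<^sup>* c' j"
    using valley_chain[of i j u] assms by auto
  have "c' = c" using first_attraction_unique[OF lc(1) lc'(1)] by simp
  then have "(parent i)\<^sup>*\<^sup>* b j"
    using parent_chain_linear[of i c b j] parent_chain_mono[OF lc(2), of i] lc'(2) assms by auto
  then have "V (min b i) (m b) \<subseteq> V i (m j)" using V_chain[of i b j] assms by (simp add: min_absorb2)
  moreover have "V k (m b) \<subseteq> V (min b i) (m b)" using assms by (intro V_mono) auto
  ultimately show ?thesis by auto
qed

text \<open>
  Take the last minimum that \<open>t\<close> reaches without climbing. If it had been removed up to level \<open>k\<close>,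
  then at the level of its removal \<open>t\<close> would be in its strict valley and thus assigned.
\<close>

lemma N_height:
  assumes "k < nn" "k = 0 \<or> t \<in> N k"
  shows "\<exists>n\<in>M (Suc k). height t n \<le> E t"
proof -
  (* The index of the last minimum reached without climbing is the maximum of J. *)
  define J where "J = {j\<in>{1..nn}. height t (m j) \<le> E t}"
  obtain n where n: "n \<in> local_minima E K" "height t n \<le> E t" by (rule downhill_to_local_minimum)
  then obtain j0 where "1 \<le> j0" "j0 \<le> nn" "n = m j0" using M_E[of 1 n] assms(1) by auto
  then have "j0 \<in> J" using n by (simp add: J_def)
  then have J: "finite J" "J \<noteq> {}" by (auto simp: J_def)
  define j where "j = Max J"
  have "j \<in> J" using Max_in[OF J] by (simp add: j_def)
  then have j: "1 \<le> j" "j \<le> nn" "height t (m j) \<le> E t" by (auto simp: J_def)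
  have up: "j' \<le> j" if "j' \<in> J" for j' using that J by (simp add: j_def)
  show ?thesis
  proof (cases "Suc k \<le> j")
    case True
    then have "m j \<in> M (Suc k)" using M_eq[of "Suc k"] j by auto
    then show ?thesis using j by blast
  next
    case False
    have "height t (m j) < height t y" if y: "y \<in> M j - {m j}" for y
    proof -
      obtain j' where j': "j \<le> j'" "j' \<le> nn" "y = m j'" using M_E[of j y] y j by auto
      then have "j' \<noteq> j" using y by auto
      then have "j' \<notin> J" using up[of j'] j' by auto
      then show ?thesis using j' j by (auto simp: J_def)
    qed
    then have "t \<in> strict_basin (M j) (m j)" by (simp add: strict_basin_def)
    then have "t \<notin> N j" using attracted_among_not_N[OF strict_basin_attracted] m_in_M j by simp
    then show ?thesis using N_antimono[of j k] False assms j by auto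
  qed
qed

text \<open>
  Before its first attraction the state is non-assigned and therefore reaches some minimum without
  climbing.
\<close>

lemma first_attraction_height: "first_attraction s k b \<Longrightarrow> height s (m b) \<le> E s"
proof -
  assume f: "first_attraction s k b"
  note f' = first_attractionD[OF f]
  have "\<exists>n\<in>M (Suc (k - 1)). height s n \<le> E s" using f' by (intro N_height) auto
  then obtain n where "n \<in> M k" "height s n \<le> E s" using f' by auto
  then show ?thesis using attracted_amongD(2)[OF f'(4)] by force
qed

lemma first_attraction_down:
  assumes "first_attraction s k b" "K s t" "E t < E s" shows "attracted_among (M k) t (m b)"
  using attracted_among_edge[OF first_attractionD(4)[OF assms(1)] assms(2)] height_ge_left[of s "m b"] assms(3) by simp

lemma not_N_first_attraction:
  assumes "t \<notin> N i" "1 \<le> i" obtains l b where "l \<le> i" "first_attraction t l b"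
proof -
  obtain j where j: "1 \<le> j" "j \<le> nn" "t \<in> V (min i j) (m j)" using assms by (auto elim: not_N_E)
  then show ?thesis using valley_chain[of "min i j" j t] assms that by auto
qed

text \<open>
  Distinct valleys of one level are not adjacent: of two assigned neighbours, the lower one is
  attracted by the minimum which first attracts the higher one, so they share a valley at that level,
  and nestedness carries this over to level \<open>i\<close>.
\<close>

lemma V_closed:
  assumes "1 \<le> i" "i \<le> j" "j \<le> nn" "s \<in> V i (m j)" "K s t" "t \<notin> N i"
  shows "t \<in> V i (m j)"
proof -
  have main: "t \<in> V i (m j)" if "l \<le> i" "1 \<le> l" "l \<le> b" "b \<le> nn" "s \<in> V l (m b)" "t \<in> V l (m b)" for l b
    using V_nested[of s l b i j] that assms by auto
  consider "s = t" | "E t < E s" | "E s < E t" using inj_E by (metis injD linorder_neqE_linordered_idom)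
  then show ?thesis
  proof cases
    case 1
    then show ?thesis using assms by simp
  next
    case 2
    obtain l b where lb: "l \<le> i" "first_attraction s l b" using valley_chain[of i j s] assms by auto
    note f = first_attractionD[OF lb(2)]
    show ?thesis
      using main[OF lb(1) f(1-3) first_attraction_V[OF lb(2)] attracted_among_in_V[OF first_attraction_down[OF lb(2) assms(5) 2] f(1-3)]] .
  next
    case 3
    obtain l b where lb: "l \<le> i" "first_attraction t l b" using not_N_first_attraction assms by blast
    note f = first_attractionD[OF lb(2)]
    show ?thesis
      using main[OF lb(1) f(1-3) attracted_among_in_V[OF first_attraction_down[OF lb(2) K_sym[OF assms(5)] 3] f(1-3)] first_attraction_V[OF lb(2)]] .
  qed
qed

lemma first_attraction_m: "1 \<le> j \<Longrightarrow> j \<le> nn \<Longrightarrow> first_attraction (m j) 1 j"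
  using strict_basin_attracted[OF local_minimum_in_strict_basin, of "M 1" "m j"] M_eq[of 1] by (auto simp: first_attraction_def)

lemma m_in_V: "1 \<le> i \<Longrightarrow> i \<le> j \<Longrightarrow> j \<le> nn \<Longrightarrow> m j \<in> V i (m j)"
  using first_attraction_V[OF first_attraction_m, of j] V_mono[of 1 i "m j"] by auto

lemma m_in_V_unique:
  assumes "1 \<le> i" "i \<le> j" "j \<le> nn" "i \<le> j'" "j' \<le> nn" "m j' \<in> V i (m j)"
  shows "j' = j"
proof -
  obtain l b where lb: "first_attraction (m j') l b" "(parent i)\<^sup>*\<^sup>* b j"
    using valley_chain[of i j "m j'"] assms by auto
  have "b = j'" using first_attraction_unique[OF lb(1) first_attraction_m] assms by auto
  then show ?thesis using parent_chain_end[OF lb(2)] assms by simp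
qed

section \<open>The barrier around a valley\<close>

definition barrier :: "nat \<Rightarrow> 's \<Rightarrow> real" where
  "barrier i x = Min (height x ` (M i - {x}))"

lemma others_nonempty:
  assumes "1 \<le> i" "i < nn" shows "M i - {x} \<noteq> {}"
proof
  assume "M i - {x} = {}"
  then have "M i \<subseteq> {x}" by auto
  then have "card (M i) \<le> 1" using card_mono[of "{x}" "M i"] by simp
  then show False using card_M[of i] assms by simp
qed

lemma barrier_le: "y \<in> M i \<Longrightarrow> y \<noteq> x \<Longrightarrow> barrier i x \<le> height x y"
  unfolding barrier_def by (rule Min_le) auto

lemma barrier_attained:
  assumes "1 \<le> i" "i < nn"
  obtains y where "y \<in> M i" "y \<noteq> x" "barrier i x = height x y"
proof -
  have "barrier i x \<in> height x ` (M i - {x})"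
    unfolding barrier_def using others_nonempty[OF assms] by (intro Min_in) auto
  then show ?thesis using that by auto
qed

lemma activation_eq: "activation_energy E K (M i) x = barrier i x - E x"
  by (simp add: activation_energy_def barrier_def)

text \<open>
  By the ultrametric inequality a state below the barrier is no closer to any other minimum than
  \<open>x\<close> is.
\<close>

lemma in_strict_basin_iff_barrier:
  assumes "1 \<le> i" "i < nn"
  shows "t \<in> strict_basin (M i) x \<longleftrightarrow> height t x < barrier i x"
proof
  assume t: "t \<in> strict_basin (M i) x"
  obtain y where y: "y \<in> M i" "y \<noteq> x" "barrier i x = height x y"
    using barrier_attained[OF assms] by blast
  show "height t x < barrier i x"
  proof (rule ccontr)
    assume "\<not> ?thesis"
    then have "height t y \<le> height t x" using y(3) height_ultra[of t x "height t x" y] by simp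
    then show False using strict_basinD[OF t y(1,2)] by simp
  qed
next
  assume t: "height t x < barrier i x"
  have "height t x < height t y" if y: "y \<in> M i - {x}" for y
  proof (rule ccontr)
    assume "\<not> ?thesis"
    then have "height x y \<le> height t x" using height_ultra[of x t "height t x" y] height_sym[of x t] by simp
    then show False using barrier_le[of y i x] y t by simp
  qed
  then show "t \<in> strict_basin (M i) x" by (simp add: strict_basin_def)
qed

text \<open>
  The non-assigned state \<open>t\<close> reaches some surviving minimum \<open>n\<close> without climbing. Following the
  mergers from the first attraction of \<open>s\<close> to \<open>j\<close>, each minimum on the way
  is reached from \<open>t\<close> without climbing: it merges into a closest one, and \<open>n\<close> is always a
  competitor.
\<close>

lemma boundary_height:
  assumes "1 \<le> i" "i < nn" "i \<le> j" "j \<le> nn" "s \<in> V i (m j)" "K s t" "t \<in> N i"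
  shows "height t (m j) \<le> E t"
proof -
  have s_not: "s \<notin> N i" using V_not_N[OF assms(5,1) order_refl assms(3,4)] .
  obtain l b where lb: "l \<le> i" "first_attraction s l b" "(parent i)\<^sup>*\<^sup>* b j"
    using valley_chain[of i j s] assms by auto
  note f = first_attractionD[OF lb(2)]
  (* Otherwise t would be attracted together with s, hence assigned. *)
  have up: "E s < E t"
  proof (rule ccontr)
    assume "\<not> ?thesis"
    moreover have "s \<noteq> t" using s_not assms(7) by auto
    ultimately have "E t < E s" using inj_E by (metis injD linorder_neqE_linordered_idom)
    then have "t \<notin> N l" using attracted_among_not_N[OF first_attraction_down[OF lb(2) assms(6)]] f by simp
    then show False using N_antimono[OF f(1) lb(1)] assms(7) by auto
  qed
  have "height t s \<le> E t" using height_edge[OF K_sym[OF assms(6)]] up by simp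
  moreover have "height s (m b) \<le> E t" using first_attraction_height[OF lb(2)] up by simp
  ultimately have start: "height t (m b) \<le> E t" by (rule height_ultra)
  obtain n where n: "n \<in> M (Suc i)" "height t n \<le> E t" using N_height[of i t] assms by auto
  show ?thesis using lb(3)
  proof (induction rule: rtranclp_induct)
    case base
    then show ?case using start .
  next
    case (step c d)
    obtain l where l: "l \<le> i" "1 \<le> l" "attracted_among (M l) (m c) (m d)"
      using step.hyps(2) by (elim parentE) auto
    have "n \<in> M l" using n(1) M_antimono[of l "Suc i"] l by auto
    then have "height (m c) (m d) \<le> height (m c) n" by (rule attracted_amongD(2)[OF l(3)])
    also have "\<dots> \<le> E t" using height_ultra[of "m c" t "E t" n] step.IH n(2) height_sym[of "m c" t] by simp
    finally show ?case using height_ultra[OF step.IH] by simp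
  qed
qed

lemma boundary_ge_barrier:
  assumes "1 \<le> i" "i < nn" "i \<le> j" "j \<le> nn" "s \<in> V i (m j)" "K s t" "t \<in> N i"
  shows "barrier i (m j) \<le> E t"
proof (rule ccontr)
  assume "\<not> ?thesis"
  then have "t \<in> strict_basin (M i) (m j)"
    using boundary_height[OF assms] in_strict_basin_iff_barrier[OF assms(1,2)] by simp
  moreover have "m j \<in> M i" using M_eq[of i] assms by auto
  ultimately show False using attracted_among_not_N[OF strict_basin_attracted] assms by auto
qed

text \<open>
  A boundary state is non-assigned, but below the barrier it would be in the strict valley of \<open>x\<close>.
  Conversely the cheapest path to another minimum leaves the valley without climbing above the
  barrier.
\<close>

lemma exit_energy:
  assumes "1 \<le> i" "i < nn" "x \<in> M i"
  shows "E (exit_state E K m i x) = barrier i x"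
proof -
  obtain j where j: "i \<le> j" "j \<le> nn" "x = m j" using M_E[of i x] assms by auto
  let ?B = "outer_boundary K (V i x)"
  have ge: "barrier i x \<le> E t" if t: "t \<in> ?B" for t
  proof -
    obtain s where s: "s \<in> V i x" "K s t" "t \<notin> V i x"
      using t K_sym by (auto simp: outer_boundary_def neighbour_def) 
    then have "t \<in> N i" using V_closed[of i j s t] j assms by auto
    then show ?thesis using boundary_ge_barrier[of i j s t] s j assms by auto
  qed
  obtain y where y: "y \<in> M i" "y \<noteq> x" "barrier i x = height x y"
    using barrier_attained[OF assms(1,2)] by blast
  obtain j' where j': "i \<le> j'" "j' \<le> nn" "y = m j'" using M_E[of i y] y assms by auto
  have "y \<notin> V i x" using m_in_V_unique[of i j j'] j j' y assms by auto
  then have "\<not> joined K (below (barrier i x) - (- V i x)) x y" using joined_right by fastforce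
  moreover have "joined K (below (barrier i x)) x y" using y by (intro joined_below) simp
  moreover have xV: "x \<in> V i x" using m_in_V[of i j] j assms by simp
  ultimately obtain u v where uv: "u \<notin> V i x" "joined K (below (barrier i x)) u y"
      "joined K (below (barrier i x) - (- V i x)) x v" "K v u"
    using joined_first_visit[of K "below (barrier i x)" x y "- V i x"] by auto
  have "v \<in> V i x" using joined_right[OF uv(3)] by simp
  then have u: "u \<in> ?B" "E u \<le> barrier i x"
    using uv(1,4) joined_left[OF uv(2)] by (auto simp: outer_boundary_def neighbour_def)
  then have "?B \<noteq> {}" by auto
  then have "arg_min_on E ?B \<in> ?B" "E (arg_min_on E ?B) \<le> E u"
    using arg_min_if_finite(1)[of ?B E] arg_min_least[of ?B u E] u(1) by auto
  then show ?thesis unfolding exit_state_def using ge u(2) by force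
qed

text \<open>
  The removed minima are treated by downward induction on their index. The minimum \<open>m j\<close> reaches
  the next minimum \<open>z\<close> by climbing its activation energy, which is minimal at level \<open>j\<close> and so
  at most that of \<open>x\<close>. Comparing with the activation energy of \<open>z\<close> instead gives \<open>E z \<le> E (m j)\<close>,
  so what can be reached from \<open>z\<close> by climbing this much can be reached from \<open>m j\<close> too.
\<close>

lemma depth:
  assumes "1 \<le> i" "i < nn" "x \<in> M i"
  shows "\<exists>y\<in>M i - {x}. height u y \<le> E u + (barrier i x - E x)"
proof -
  have key: "\<exists>y\<in>M i - {x}. height (m j) y \<le> E (m j) + (barrier i x - E x)" if "1 \<le> j" "j \<le> nn" for j
    using that
  proof (induction "nn - j" arbitrary: j rule: less_induct)
    case less
    obtain y where y: "y \<in> M i" "y \<noteq> x" "barrier i x = height x y"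
      using barrier_attained[OF assms(1,2)] by blast
    have bx: "E x \<le> barrier i x" using y(3) height_ge_left by simp
    show ?case
    proof (cases "i \<le> j")
      case True
      show ?thesis
      proof (cases "m j = x")
        case True
        then show ?thesis using y by auto
      next
        case False
        moreover have "m j \<in> M i" using M_eq[of i] True less.prems assms by auto
        ultimately show ?thesis using bx by (intro bexI[of _ "m j"]) (auto simp: height_self)
      qed
    next
      case False
      then have jn: "j < nn" using assms by simp
      obtain z where z: "z \<in> M j" "z \<noteq> m j" "barrier j (m j) = height (m j) z"
        using barrier_attained[OF less.prems(1) jn] by blast
      obtain j1 where j1: "j \<le> j1" "j1 \<le> nn" "z = m j1" using M_E[OF less.prems z(1)] by blast
      have "j \<noteq> j1" using z j1 by auto
      then have "j < j1" using j1 by simp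
      (* The defining property of the enumeration at level j. *)
      have min: "barrier j (m j) - E (m j) \<le> barrier j w - E w" if "w \<in> M j" for w
        using meta that less.prems jn unfolding meta_enumeration_def is_arg_min_def
        by (auto simp: activation_eq not_less)
      have sub: "M i \<subseteq> M j" using M_antimono[of j i] False less.prems by simp
      have "barrier j x \<le> barrier i x" using barrier_le[of y j x] y sub by auto
      then have D: "barrier j (m j) - E (m j) \<le> barrier i x - E x"
        using min[of x] assms(3) sub by auto
      have "barrier j z \<le> height (m j) z"
        using barrier_le[of "m j" j z] m_in_M[of j] less.prems z(2) height_sym[of z "m j"] by auto
      then have Ez: "E z \<le> E (m j)" using min[OF z(1)] z(3) by simp
      obtain w where w: "w \<in> M i - {x}" "height z w \<le> E z + (barrier i x - E x)"
        using less.hyps[of j1, OF diff_less_mono2[OF \<open>j < j1\<close> jn]] \<open>j < j1\<close> j1 less.prems by auto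
      have "height (m j) w \<le> E (m j) + (barrier i x - E x)"
        using height_ultra[of "m j" z "E (m j) + (barrier i x - E x)" w] w(2) Ez D z(3) by simp
      then show ?thesis using w(1) by blast
    qed
  qed
  obtain n where n: "n \<in> local_minima E K" "height u n \<le> E u" by (rule downhill_to_local_minimum)
  then obtain j where j: "1 \<le> j" "j \<le> nn" "n = m j" using M_E[of 1 n] assms by auto
  obtain y where y: "y \<in> M i - {x}" "height n y \<le> E n + (barrier i x - E x)" using key[OF j(1,2)] j(3) by auto
  have "E x \<le> barrier i x" using barrier_attained[OF assms(1,2), of x] height_ge_left by metis
  moreover have "E n \<le> E u" using height_ge_right[of n u] n(2) by simp
  ultimately have "height u y \<le> E u + (barrier i x - E x)"
    using height_ultra[of u n "E u + (barrier i x - E x)" y] n(2) y(2) by simp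
  then show ?thesis using y(1) by blast
qed

end

section \<open>Survival and hitting probabilities of a stochastic matrix\<close>

locale stochastic_matrix =
  fixes Q :: "'s::finite \<Rightarrow> 's \<Rightarrow> real"
  assumes Q_nonneg: "0 \<le> Q r s"
    and Q_sum: "(\<Sum>s\<in>UNIV. Q r s) = 1"
begin

definition mean :: "('s \<Rightarrow> real) \<Rightarrow> 's \<Rightarrow> real" where
  "mean f y = (\<Sum>v\<in>UNIV. Q y v * f v)"

lemma mean_mono: "(\<And>v. 0 < Q y v \<Longrightarrow> f v \<le> g v) \<Longrightarrow> mean f y \<le> mean g y"
  unfolding mean_def using Q_nonneg
  by (intro sum_mono) (metis less_eq_real_def mult_left_mono mult_zero_left)

lemma mean_const: "mean (\<lambda>_. c) y = c"
  unfolding mean_def using Q_sum by (simp flip: sum_distrib_right)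

lemma mean_nonneg: "(\<And>v. 0 \<le> f v) \<Longrightarrow> 0 \<le> mean f y"
  using mean_mono[of y "\<lambda>_. 0" f] mean_const[of 0 y] by simp

lemma mean_le: "(\<And>v. f v \<le> c) \<Longrightarrow> mean f y \<le> c"
  using mean_mono[of y f "\<lambda>_. c"] mean_const[of c y] by simp

lemma mean_scale: "mean (\<lambda>v. c * f v) y = c * mean f y"
  unfolding mean_def by (simp add: sum_distrib_left mult_ac)

lemma mean_add: "mean (\<lambda>v. f v + g v) y = mean f y + mean g y"
  unfolding mean_def by (simp add: sum.distrib distrib_left)

lemma mean_diff: "mean (\<lambda>v. f v - g v) y = mean f y - mean g y"
  unfolding mean_def by (simp add: sum_subtractf right_diff_distrib)

lemma mean_sum: "finite I \<Longrightarrow> mean (\<lambda>v. \<Sum>i\<in>I. f i v) y = (\<Sum>i\<in>I. mean (f i) y)"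
  by (induction rule: finite_induct) (simp_all add: mean_add mean_const)

text \<open>
  The probability that the chain started at \<open>y\<close> avoids \<open>A\<close> up to time \<open>n\<close>.
\<close>

fun survival :: "'s set \<Rightarrow> nat \<Rightarrow> 's \<Rightarrow> real" where
  "survival A 0 y = (if y \<in> A then 0 else 1)"
| "survival A (Suc n) y = (if y \<in> A then 0 else mean (survival A n) y)"

lemma survival_nonneg: "0 \<le> survival A n y"
  by (induction n arbitrary: y) (auto intro: mean_nonneg)

lemma survival_le_1: "survival A n y \<le> 1"
  by (induction n arbitrary: y) (auto intro: mean_le)

lemma survival_in: "y \<in> A \<Longrightarrow> survival A n y = 0"
  by (cases n) auto

lemma survival_decr: "survival A (Suc n) y \<le> survival A n y"
proof (induction n arbitrary: y)
  case 0
  then show ?case using mean_le[of "survival A 0" 1 y] by auto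
next
  case (Suc n)
  then show ?case using mean_mono[of y "survival A (Suc n)" "survival A n"] by (simp del: survival.simps add: survival.simps(2)[of _ "Suc n"] survival.simps(2)[of _ n])
qed

text \<open>
  The first exit from \<open>C\<close> is into both sets at once.
\<close>

lemma survival_cong_closed:
  assumes "\<And>y v. y \<in> C \<Longrightarrow> 0 < Q y v \<Longrightarrow> v \<in> C \<or> v \<in> A \<inter> A'" "C \<inter> (A \<union> A') = {}" "y \<in> C"
  shows "survival A n y = survival A' n y"
  using assms(3)
proof (induction n arbitrary: y)
  case 0
  then show ?case using assms(2) by auto
next
  case (Suc n)
  have "survival A n v = survival A' n v" if "0 < Q y v" for v
    using assms(1)[OF Suc.prems that] Suc.IH[of v] by (auto simp: survival_in)
  then have "mean (survival A n) y = mean (survival A' n) y"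
    by (intro antisym mean_mono) simp_all
  then show ?case using assms(2) Suc.prems by auto
qed

text \<open>
  The probability that the chain started at \<open>y\<close> hits \<open>z\<close> by time \<open>n\<close>, before it leaves \<open>G\<close>.
\<close>

fun hit :: "'s set \<Rightarrow> 's \<Rightarrow> nat \<Rightarrow> 's \<Rightarrow> real" where
  "hit G z 0 y = of_bool (y = z)"
| "hit G z (Suc n) y = (if y = z then 1 else if y \<in> G then mean (hit G z n) y else 0)"

lemma hit_range: "0 \<le> hit G z n y \<and> hit G z n y \<le> 1"
  by (induction n arbitrary: y) (auto intro: mean_nonneg mean_le)

lemma hit_mono: "hit G z n y \<le> hit G z (Suc n) y"
proof (induction n arbitrary: y)
  case 0
  show ?case using hit_range[of G z "Suc 0" y] by auto
next
  case (Suc n)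
  then show ?case using mean_mono[of y "hit G z n" "hit G z (Suc n)"]
    by (simp del: hit.simps add: hit.simps(2)[of _ _ "Suc n"] hit.simps(2)[of _ _ n])
qed

definition hit_lim :: "'s set \<Rightarrow> 's \<Rightarrow> 's \<Rightarrow> real" where
  "hit_lim G z y = lim (\<lambda>n. hit G z n y)"

lemma hit_tendsto: "(\<lambda>n. hit G z n y) \<longlonglongrightarrow> hit_lim G z y"
proof -
  have "incseq (\<lambda>n. hit G z n y)" by (rule incseq_SucI) (rule hit_mono)
  then obtain L where "(\<lambda>n. hit G z n y) \<longlonglongrightarrow> L"
    by (rule incseq_convergent) (use hit_range in blast)
  then show ?thesis unfolding hit_lim_def by (simp add: limI)
qed

lemma hit_lim_self: "hit_lim G z z = 1"
proof -
  have "hit G z n z = 1" for n by (cases n) auto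
  then show ?thesis using hit_tendsto[of G z z] by (simp add: LIMSEQ_const_iff)
qed

lemma hit_lim_outside: "y \<notin> G \<Longrightarrow> y \<noteq> z \<Longrightarrow> hit_lim G z y = 0"
proof -
  assume "y \<notin> G" "y \<noteq> z"
  then have "hit G z n y = 0" for n by (cases n) auto
  then show ?thesis using hit_tendsto[of G z y] by (simp add: LIMSEQ_const_iff)
qed

lemma hit_lim_harmonic:
  assumes "y \<in> G" "y \<noteq> z" shows "mean (hit_lim G z) y = hit_lim G z y"
proof -
  have "(\<lambda>n. mean (hit G z n) y) \<longlonglongrightarrow> mean (hit_lim G z) y"
    unfolding mean_def by (intro tendsto_intros hit_tendsto)
  moreover have "(\<lambda>n. hit G z (Suc n) y) \<longlonglongrightarrow> hit_lim G z y"
    using hit_tendsto by (rule LIMSEQ_Suc)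
  ultimately show ?thesis using assms by (intro LIMSEQ_unique) auto
qed

text \<open>
  A chain started in \<open>C\<close> that hits \<open>z\<close> before leaving \<open>G\<close> must first pass through \<open>T\<close>. From there it
  survives with at least \<open>c\<close> times the probability of a chain started at \<open>z\<close>, and the time spent
  before only helps, since survival probabilities decrease in time.
\<close>

lemma survival_transfer:
  assumes z: "z \<in> T" and T: "\<And>u. u \<in> T \<Longrightarrow> c * survival A n z \<le> survival A n u"
    and c: "0 \<le> c" "c \<le> 1"
    and C: "C \<inter> A = {}" "C \<inter> T = {}"
    and step: "\<And>y v. y \<in> C \<Longrightarrow> 0 < Q y v \<Longrightarrow> v \<in> C \<or> v \<in> T \<or> v \<notin> G"
    and y: "y \<in> C"
  shows "c * hit_lim G z y * survival A n z \<le> survival A n y"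
proof -
  have "c * hit G z k y * survival A n z \<le> survival A n y" for k
    using y
  proof (induction k arbitrary: y)
    case 0
    then show ?case using z C(2) survival_nonneg by auto
  next
    case (Suc k)
    have "c * hit G z k v * survival A n z \<le> survival A n v" if "0 < Q y v" for v
    proof -
      have "c * hit G z k v * survival A n z \<le> c * survival A n z"
        using hit_range[of G z k v] c survival_nonneg[of A n z]
        by (intro mult_right_mono mult_left_le) auto
      moreover have "c * hit G z k v * survival A n z \<le> survival A n v" if "v \<notin> G" "v \<notin> T"
      proof -
        have "v \<noteq> z" using that z by auto
        then have "hit G z k v = 0" using that by (cases k) auto
        then show ?thesis using survival_nonneg by simp
      qed
      ultimately show ?thesis using step[OF Suc.prems that] Suc.IH[of v] T[of v] by fastforce
    qed
    then have "mean (\<lambda>v. c * hit G z k v * survival A n z) y \<le> mean (survival A n) y" by (rule mean_mono)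
    also have "\<dots> = survival A (Suc n) y" using Suc.prems C by auto
    also have "\<dots> \<le> survival A n y" by (rule survival_decr)
    finally have *: "c * mean (hit G z k) y * survival A n z \<le> survival A n y"
      using mean_scale[of "c * survival A n z" "hit G z k" y] by (simp add: mult_ac)
    have "y \<noteq> z" using Suc.prems z C by auto
    then show ?case using * survival_nonneg by auto
  qed
  then show ?thesis
    by (intro LIMSEQ_le_const2[of "\<lambda>k. c * hit G z k y * survival A n z"] tendsto_intros hit_tendsto) auto
qed

end

section \<open>The expected exit time as a sum of survival probabilities\<close>

context stochastic_matrix
begin

definition cylinder :: "'w measure \<Rightarrow> (nat \<Rightarrow> 'w \<Rightarrow> 's) \<Rightarrow> nat \<Rightarrow> (nat \<Rightarrow> 's) \<Rightarrow> 'w set" where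
  "cylinder W Y n h = {\<omega>\<in>space W. \<forall>k\<le>n. Y k \<omega> = h k}"

definition avoid :: "'w measure \<Rightarrow> (nat \<Rightarrow> 'w \<Rightarrow> 's) \<Rightarrow> 's set \<Rightarrow> nat \<Rightarrow> 's \<Rightarrow> 'w set" where
  "avoid W Y A n y = {\<omega>\<in>space W. (\<forall>k\<le>n. Y k \<omega> \<notin> A) \<and> Y n \<omega> = y}"

context
  fixes W :: "'w measure" and Y :: "nat \<Rightarrow> 'w \<Rightarrow> 's" and x :: 's
  assumes chain: "markov_chain_from W Y Q x"
begin

interpretation prob_space W
  using chain by (simp add: markov_chain_from_def)

lemma Y_measurable [measurable]: "Y n \<in> measurable W (count_space UNIV)"
  using chain by (simp add: markov_chain_from_def)

lemma cylinder_step: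
  "prob {\<omega>\<in>cylinder W Y n h. Y (Suc n) \<omega> = t} = prob (cylinder W Y n h) * Q (h n) t"
proof (cases "prob (cylinder W Y n h) = 0")
  case True
  have "prob {\<omega>\<in>cylinder W Y n h. Y (Suc n) \<omega> = t} \<le> prob (cylinder W Y n h)"
    unfolding cylinder_def by (intro finite_measure_mono) auto
  then show ?thesis using True by (simp add: measure_le_0_iff)
next
  case False
  then have pos: "prob {\<omega>\<in>space W. \<forall>k\<le>n. Y k \<omega> = h k} > 0"
    by (simp add: cylinder_def zero_less_measure_iff)
  then have "cond_prob W (\<lambda>\<omega>. Y (Suc n) \<omega> = t) (\<lambda>\<omega>. \<forall>k\<le>n. Y k \<omega> = h k) = Q (h n) t"
    using chain unfolding markov_chain_from_def by blast
  then have "prob {\<omega>\<in>space W. Y (Suc n) \<omega> = t \<and> (\<forall>k\<le>n. Y k \<omega> = h k)} =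
      prob (cylinder W Y n h) * Q (h n) t"
    using pos unfolding cond_prob_def cylinder_def by (simp add: field_simps)
  moreover have "{\<omega>\<in>cylinder W Y n h. Y (Suc n) \<omega> = t} =
      {\<omega>\<in>space W. Y (Suc n) \<omega> = t \<and> (\<forall>k\<le>n. Y k \<omega> = h k)}"
    by (auto simp: cylinder_def)
  ultimately show ?thesis by simp
qed

text \<open>
  The Markov property is given for complete histories only, so events are split according to
  them.
\<close>

lemma prob_split_history:
  assumes Z: "Z \<in> sets W" and H: "H = {h \<in> PiE {..n} (\<lambda>_. - A). h n = y}"
    and sub: "Z \<subseteq> avoid W Y A n y"
  shows "prob Z = (\<Sum>h\<in>H. prob (Z \<inter> cylinder W Y n h))"
proof -
  have fin: "finite H" unfolding H by (intro finite_subset[OF _ finite_PiE[of "{..n}" "\<lambda>_. - A"]]) auto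
  have "Z = (\<Union>h\<in>H. Z \<inter> cylinder W Y n h)"
  proof
    show "Z \<subseteq> (\<Union>h\<in>H. Z \<inter> cylinder W Y n h)"
    proof
      fix \<omega> assume \<omega>: "\<omega> \<in> Z"
      define h where "h = restrict (\<lambda>k. Y k \<omega>) {..n}"
      have "\<omega> \<in> space W" "\<forall>k\<le>n. Y k \<omega> \<notin> A" "Y n \<omega> = y" using sub \<omega> by (auto simp: avoid_def)
      then have "h \<in> H" "\<omega> \<in> cylinder W Y n h" by (auto simp: H h_def cylinder_def)
      then show "\<omega> \<in> (\<Union>h\<in>H. Z \<inter> cylinder W Y n h)" using \<omega> by blast
    qed
  qed auto
  moreover have "disjoint_family_on (\<lambda>h. Z \<inter> cylinder W Y n h) H"
    unfolding disjoint_family_on_def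
  proof (intro ballI impI)
    fix h h' assume hh: "h \<in> H" "h' \<in> H" "h \<noteq> h'"
    have "\<exists>k\<le>n. h k \<noteq> h' k"
    proof (rule ccontr)
      assume "\<not> ?thesis"
      then have "h = h'" using hh(1,2) unfolding H by (intro PiE_ext[of h "{..n}" "\<lambda>_. - A" h']) auto
      then show False using hh by simp
    qed
    then show "(Z \<inter> cylinder W Y n h) \<inter> (Z \<inter> cylinder W Y n h') = {}"
      by (auto simp: cylinder_def)
  qed
  moreover have "Z \<inter> cylinder W Y n h \<in> sets W" for h
    using Z unfolding cylinder_def by measurable
  ultimately show ?thesis
    using finite_measure_finite_Union[OF fin, of "\<lambda>h. Z \<inter> cylinder W Y n h"] by auto
qed

lemma avoid_sets: "avoid W Y A n y \<in> sets W"
  unfolding avoid_def by measurable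

lemma avoid_step:
  "prob {\<omega>\<in>avoid W Y A n y. Y (Suc n) \<omega> = t} = prob (avoid W Y A n y) * Q y t"
proof -
  define H where "H = {h \<in> PiE {..n} (\<lambda>_. - A). h n = y}"
  have cyl: "cylinder W Y n h \<subseteq> avoid W Y A n y" if "h \<in> H" for h
    using that by (auto simp: H_def cylinder_def avoid_def PiE_def Pi_def)
  have "{\<omega>\<in>avoid W Y A n y. Y (Suc n) \<omega> = t} \<in> sets W"
    unfolding avoid_def by measurable
  then have "prob {\<omega>\<in>avoid W Y A n y. Y (Suc n) \<omega> = t} =
      (\<Sum>h\<in>H. prob ({\<omega>\<in>avoid W Y A n y. Y (Suc n) \<omega> = t} \<inter> cylinder W Y n h))"
    by (rule prob_split_history[OF _ H_def]) auto
  also have "\<dots> = (\<Sum>h\<in>H. prob {\<omega>\<in>cylinder W Y n h. Y (Suc n) \<omega> = t})"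
  proof (rule sum.cong[OF refl])
    fix h assume "h \<in> H"
    then have "{\<omega>\<in>avoid W Y A n y. Y (Suc n) \<omega> = t} \<inter> cylinder W Y n h =
        {\<omega>\<in>cylinder W Y n h. Y (Suc n) \<omega> = t}" using cyl by auto
    then show "prob ({\<omega>\<in>avoid W Y A n y. Y (Suc n) \<omega> = t} \<inter> cylinder W Y n h) =
        prob {\<omega>\<in>cylinder W Y n h. Y (Suc n) \<omega> = t}" by simp
  qed
  also have "\<dots> = (\<Sum>h\<in>H. prob (cylinder W Y n h) * Q y t)"
    by (intro sum.cong refl) (simp add: cylinder_step H_def)
  also have "\<dots> = (\<Sum>h\<in>H. prob (avoid W Y A n y \<inter> cylinder W Y n h)) * Q y t"
    unfolding sum_distrib_right using cyl by (intro sum.cong refl) (metis inf.absorb2)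
  also have "(\<Sum>h\<in>H. prob (avoid W Y A n y \<inter> cylinder W Y n h)) = prob (avoid W Y A n y)"
    by (rule prob_split_history[OF avoid_sets H_def, symmetric]) auto
  finally show ?thesis .
qed

lemma avoid_Suc:
  "prob (avoid W Y A (Suc n) t) = (if t \<in> A then 0 else \<Sum>y\<in>UNIV. prob (avoid W Y A n y) * Q y t)"
proof (cases "t \<in> A")
  case True
  then have "avoid W Y A (Suc n) t = {}" by (auto simp: avoid_def)
  then show ?thesis using True by simp
next
  case False
  have "avoid W Y A (Suc n) t = (\<Union>y\<in>UNIV. {\<omega>\<in>avoid W Y A n y. Y (Suc n) \<omega> = t})"
    using False by (auto simp: avoid_def le_Suc_eq)
  moreover have "disjoint_family_on (\<lambda>y. {\<omega>\<in>avoid W Y A n y. Y (Suc n) \<omega> = t}) UNIV"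
    by (auto simp: disjoint_family_on_def avoid_def)
  moreover have "{\<omega>\<in>avoid W Y A n y. Y (Suc n) \<omega> = t} \<in> sets W" for y
    unfolding avoid_def by measurable
  ultimately have "prob (avoid W Y A (Suc n) t) = (\<Sum>y\<in>UNIV. prob {\<omega>\<in>avoid W Y A n y. Y (Suc n) \<omega> = t})"
    using finite_measure_finite_Union[of UNIV "\<lambda>y. {\<omega>\<in>avoid W Y A n y. Y (Suc n) \<omega> = t}"] by auto
  then show ?thesis using False avoid_step by simp
qed

text \<open>
  Steps are moved one at a time from the forward evolution of the law to the backward recursion
  of the survival probability.
\<close>

lemma avoid_survival_shift:
  "(\<Sum>y\<in>UNIV. prob (avoid W Y A n y) * survival A k y) = survival A (n + k) x"
proof (induction n arbitrary: k)
  case 0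
  have "AE \<omega> in W. Y 0 \<omega> = x" using chain by (simp add: markov_chain_from_def)
  then have "prob {\<omega>\<in>space W. Y 0 \<omega> = y} = of_bool (y = x)" for y
    by (cases "y = x") (auto simp: prob_Collect_eq_1 prob_Collect_eq_0 elim: eventually_mono)
  moreover have "avoid W Y A 0 y = (if y \<in> A then {} else {\<omega>\<in>space W. Y 0 \<omega> = y})" for y
    by (auto simp: avoid_def)
  ultimately have "prob (avoid W Y A 0 y) * survival A k y = (if y = x then survival A k x else 0)" for y
    by (auto simp: survival_in)
  then show ?case by simp
next
  case (Suc n)
  have "(\<Sum>t\<in>UNIV. prob (avoid W Y A (Suc n) t) * survival A k t) =
      (\<Sum>t\<in>UNIV. \<Sum>y\<in>UNIV. prob (avoid W Y A n y) * (Q y t * survival A k t))"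
    by (intro sum.cong refl) (simp add: avoid_Suc survival_in sum_distrib_right mult.assoc)
  also have "\<dots> = (\<Sum>y\<in>UNIV. prob (avoid W Y A n y) * mean (survival A k) y)"
    by (subst sum.swap) (simp add: mean_def sum_distrib_left)
  also have "\<dots> = (\<Sum>y\<in>UNIV. prob (avoid W Y A n y) * survival A (Suc k) y)"
  proof (intro sum.cong refl)
    fix y
    have "avoid W Y A n y = {}" if "y \<in> A" using that by (auto simp: avoid_def)
    then show "prob (avoid W Y A n y) * mean (survival A k) y = prob (avoid W Y A n y) * survival A (Suc k) y"
      by auto
  qed
  finally show ?case using Suc[of "Suc k"] by (simp del: survival.simps)
qed

lemma prob_avoid: "prob {\<omega>\<in>space W. \<forall>k\<le>n. Y k \<omega> \<notin> A} = survival A n x"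
proof -
  have "{\<omega>\<in>space W. \<forall>k\<le>n. Y k \<omega> \<notin> A} = (\<Union>y\<in>UNIV. avoid W Y A n y)"
    by (auto simp: avoid_def)
  moreover have "disjoint_family_on (avoid W Y A n) UNIV"
    by (auto simp: disjoint_family_on_def avoid_def)
  ultimately have "prob {\<omega>\<in>space W. \<forall>k\<le>n. Y k \<omega> \<notin> A} = (\<Sum>y\<in>UNIV. prob (avoid W Y A n y))"
    using finite_measure_finite_Union[of UNIV "avoid W Y A n"] avoid_sets
    by (simp add: image_subset_iff)
  also have "\<dots> = (\<Sum>y\<in>UNIV. prob (avoid W Y A n y) * survival A 0 y)"
  proof (intro sum.cong refl)
    fix y
    have "avoid W Y A n y = {}" if "y \<in> A" using that by (auto simp: avoid_def)
    then show "prob (avoid W Y A n y) = prob (avoid W Y A n y) * survival A 0 y" by auto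
  qed
  finally show ?thesis using avoid_survival_shift[of A n 0] by simp
qed

lemma zeta0_greater_iff:
  assumes "Y 0 \<omega> \<notin> A"
  shows "enat n < zeta0 A Y \<omega> \<longleftrightarrow> (\<forall>k\<le>n. Y k \<omega> \<notin> A)"
proof -
  have "xi0 A Y \<omega> \<le> enat 0" unfolding xi0_def using assms by (intro Inf_lower) blast
  then have xi: "xi0 A Y \<omega> \<le> enat k" for k by (simp add: zero_enat_def[symmetric])
  define S where "S = {enat k | k. Y k \<omega> \<in> A}"
  have z: "zeta0 A Y \<omega> = Inf S" unfolding zeta0_def S_def using xi by simp
  show ?thesis
  proof
    assume n: "enat n < zeta0 A Y \<omega>"
    show "\<forall>k\<le>n. Y k \<omega> \<notin> A"
    proof (intro allI impI notI)
      fix k assume k: "k \<le> n" "Y k \<omega> \<in> A"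
      then have "Inf S \<le> enat k" by (intro Inf_lower) (auto simp: S_def)
      also have "\<dots> \<le> enat n" using k by simp
      finally show False using n z by simp
    qed
  next
    assume n: "\<forall>k\<le>n. Y k \<omega> \<notin> A"
    have "enat (Suc n) \<le> Inf S"
    proof (rule Inf_greatest)
      fix s assume "s \<in> S"
      then obtain k where "s = enat k" "Y k \<omega> \<in> A" by (auto simp: S_def)
      then show "enat (Suc n) \<le> s" using n by (auto simp: not_le[symmetric] Suc_le_eq)
    qed
    then show "enat n < zeta0 A Y \<omega>" using z by (metis Suc_ile_eq)
  qed
qed

text \<open>
  The start outside \<open>A\<close> makes the first waiting time vanish, so that the expectation is that of the
  hitting time of \<open>A\<close>, summed by its tails.
\<close>

lemma expected_zeta0_eq:
  assumes "x \<notin> A"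
  shows "expected_zeta0 W A Y = (\<Sum>n. ennreal (survival A n x))"
proof -
  have AE: "AE \<omega> in W. Y 0 \<omega> \<notin> A"
    using chain assms by (auto simp: markov_chain_from_def elim: eventually_mono)
  have enat: "ennreal_of_enat z = (\<Sum>n. indicator {z. enat n < z} z)" for z :: enat
  proof (cases z)
    case (enat k)
    have "(\<Sum>n. indicator {z. enat n < z} z :: ennreal) = (\<Sum>n<k. 1)"
      using enat by (subst suminf_finite[of "{..<k}"]) auto
    then show ?thesis using enat by simp
  next
    case infinity
    have "(\<Sum>n. 1 :: ennreal) = top"
      by (simp add: suminf_eq_SUP ennreal_SUP_of_nat_eq_top)
    then show ?thesis using infinity by simp
  qed
  have "expected_zeta0 W A Y = (\<integral>\<^sup>+ \<omega>. (\<Sum>n. indicator {\<omega>\<in>space W. \<forall>k\<le>n. Y k \<omega> \<notin> A} \<omega>) \<partial>W)"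
    unfolding expected_zeta0_def enat
    by (intro nn_integral_cong_AE AE_mp[OF AE AE_I2] impI suminf_cong)
      (auto simp: zeta0_greater_iff indicator_def)
  also have "\<dots> = (\<Sum>n. \<integral>\<^sup>+ \<omega>. indicator {\<omega>\<in>space W. \<forall>k\<le>n. Y k \<omega> \<notin> A} \<omega> \<partial>W)"
    by (rule nn_integral_suminf) measurable
  also have "\<dots> = (\<Sum>n. ennreal (survival A n x))"
    by (intro suminf_cong) (simp add: emeasure_eq_measure prob_avoid)
  finally show ?thesis .
qed

end
end

section \<open>Dirichlet forms of reversible matrices\<close>

locale reversible_matrix = stochastic_matrix Q for Q :: "'s::finite \<Rightarrow> 's \<Rightarrow> real" +
  fixes w :: "'s \<Rightarrow> real"
  assumes w_pos: "0 < w r"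
    and balance: "w r * Q r s = w s * Q s r"
begin

text \<open>
  Every edge is counted in both directions, so this is twice the usual Dirichlet form.
\<close>

definition dirichlet :: "('s \<Rightarrow> real) \<Rightarrow> real" where
  "dirichlet f = (\<Sum>u\<in>UNIV. \<Sum>v\<in>UNIV. w u * Q u v * (f u - f v)\<^sup>2)"

lemma energy_bilinear:
  "(\<Sum>u\<in>UNIV. \<Sum>v\<in>UNIV. w u * Q u v * ((f u - f v) * (g u - g v))) =
     2 * (\<Sum>u\<in>UNIV. w u * g u * (f u - mean f u))"
proof -
  have a: "(\<Sum>u\<in>UNIV. \<Sum>v\<in>UNIV. w u * Q u v * ((f u - f v) * g u)) = (\<Sum>u\<in>UNIV. w u * g u * (f u - mean f u))"
  proof (rule sum.cong[OF refl])
    fix u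
    have "(\<Sum>v\<in>UNIV. w u * Q u v * ((f u - f v) * g u)) = w u * g u * (\<Sum>v\<in>UNIV. Q u v * f u - Q u v * f v)"
      by (simp add: sum_distrib_left algebra_simps)
    also have "(\<Sum>v\<in>UNIV. Q u v * f u - Q u v * f v) = f u - mean f u"
      by (simp add: sum_subtractf mean_def Q_sum flip: sum_distrib_right)
    finally show "(\<Sum>v\<in>UNIV. w u * Q u v * ((f u - f v) * g u)) = w u * g u * (f u - mean f u)" .
  qed
  have "(\<Sum>u\<in>UNIV. \<Sum>v\<in>UNIV. w u * Q u v * ((f u - f v) * g v)) =
        (\<Sum>v\<in>UNIV. \<Sum>u\<in>UNIV. w u * Q u v * ((f u - f v) * g v))"
    by (rule sum.swap)
  also have "\<dots> = (\<Sum>v\<in>UNIV. \<Sum>u\<in>UNIV. - (w v * Q v u * ((f v - f u) * g v)))"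
    by (intro sum.cong refl) (simp add: balance algebra_simps)
  also have "\<dots> = - (\<Sum>u\<in>UNIV. w u * g u * (f u - mean f u))"
    by (simp add: sum_negf a)
  finally have b: "(\<Sum>u\<in>UNIV. \<Sum>v\<in>UNIV. w u * Q u v * ((f u - f v) * g v)) = \<dots>" .
  have "(\<Sum>u\<in>UNIV. \<Sum>v\<in>UNIV. w u * Q u v * ((f u - f v) * (g u - g v))) =
      (\<Sum>u\<in>UNIV. \<Sum>v\<in>UNIV. w u * Q u v * ((f u - f v) * g u)) -
      (\<Sum>u\<in>UNIV. \<Sum>v\<in>UNIV. w u * Q u v * ((f u - f v) * g v))"
    by (simp add: sum_subtractf[symmetric] right_diff_distrib)
  then show ?thesis using a b by simp
qed

lemma dirichlet_eq: "dirichlet f = 2 * (\<Sum>u\<in>UNIV. w u * f u * (f u - mean f u))"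
  using energy_bilinear[of f f] by (simp add: dirichlet_def power2_eq_square)

lemma dirichlet_nonneg: "0 \<le> dirichlet f"
  unfolding dirichlet_def by (intro sum_nonneg) (simp add: w_pos Q_nonneg less_imp_le)

lemma edge_le_dirichlet: "w a * Q a b * (f a - f b)\<^sup>2 \<le> dirichlet f"
proof -
  have nonneg: "0 \<le> w u * Q u v * (f u - f v)\<^sup>2" for u v
    by (simp add: w_pos Q_nonneg less_imp_le)
  have "w a * Q a b * (f a - f b)\<^sup>2 \<le> (\<Sum>v\<in>UNIV. w a * Q a v * (f a - f v)\<^sup>2)"
    by (rule member_le_sum) (use nonneg in auto)
  also have "\<dots> \<le> dirichlet f" unfolding dirichlet_def
    by (rule member_le_sum[of a UNIV "\<lambda>u. \<Sum>v\<in>UNIV. w u * Q u v * (f u - f v)\<^sup>2"])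
      (auto intro!: sum_nonneg nonneg)
  finally show ?thesis .
qed

lemma edge_difference:
  assumes "0 < \<kappa>" "\<kappa> \<le> w a * Q a b"
  shows "\<bar>f a - f b\<bar> \<le> sqrt (dirichlet f / \<kappa>)"
proof (rule real_le_rsqrt)
  have "\<kappa> * (f a - f b)\<^sup>2 \<le> w a * Q a b * (f a - f b)\<^sup>2" by (intro mult_right_mono assms) simp
  then have "\<kappa> * (f a - f b)\<^sup>2 \<le> dirichlet f" using edge_le_dirichlet[of a b f] by simp
  then show "\<bar>f a - f b\<bar>\<^sup>2 \<le> dirichlet f / \<kappa>" using assms(1) by (simp add: pos_le_divide_eq mult.commute)
qed

text \<open>
  The expected number of visits to \<open>u\<close> before time \<open>n\<close> and before hitting \<open>A\<close>. The truncation in time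
  avoids having to prove recurrence first; all bounds are uniform in \<open>n\<close>.
\<close>

fun green :: "'s set \<Rightarrow> 's \<Rightarrow> nat \<Rightarrow> 's \<Rightarrow> real" where
  "green A u 0 y = 0"
| "green A u (Suc n) y = (if y \<in> A then 0 else of_bool (y = u) + mean (green A u n) y)"

lemma green_nonneg: "0 \<le> green A u n y"
  by (induction n arbitrary: y) (auto intro!: mean_nonneg add_nonneg_nonneg)

lemma green_mono: "green A u n y \<le> green A u (Suc n) y"
proof (induction n arbitrary: y)
  case 0
  show ?case using green_nonneg[of A u "Suc 0" y] by simp
next
  case (Suc n)
  then show ?case using mean_mono[of y "green A u n" "green A u (Suc n)"]
    by (simp del: green.simps add: green.simps(2)[of _ _ "Suc n"] green.simps(2)[of _ _ n])
qed

text \<open>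
  Before the first visit to \<open>u\<close> nothing is counted.
\<close>

lemma green_diagonal: "green A u n y \<le> green A u n u"
proof (induction n arbitrary: y)
  case (Suc n)
  show ?case
  proof (cases "y = u \<or> y \<in> A")
    case True
    then consider "y = u" | "green A u (Suc n) y = 0" by auto
    then show ?thesis using green_nonneg[of A u "Suc n" u] by cases (simp_all del: green.simps)
  next
    case False
    then have "green A u (Suc n) y = mean (green A u n) y" by simp
    also have "\<dots> \<le> green A u n u" by (rule mean_le) (rule Suc)
    also have "\<dots> \<le> green A u (Suc n) u" by (rule green_mono)
    finally show ?thesis .
  qed
qed simp

lemma sum_survival_Suc:
  "(\<Sum>k<Suc n. survival A k y) = (if y \<in> A then 0 else 1 + mean (\<lambda>v. \<Sum>k<n. survival A k v) y)"
  unfolding sum.lessThan_Suc_shift by (auto simp: mean_sum)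

lemma sum_green: "(\<Sum>u\<in>UNIV. green A u n y) = (\<Sum>k<n. survival A k y)"
proof (induction n arbitrary: y)
  case (Suc n)
  show ?case unfolding sum_survival_Suc
    by (auto simp: sum.distrib mean_sum[symmetric] Suc)
qed simp

text \<open>
  The untruncated Green function solves a Poisson equation with a unit source at \<open>u\<close>. By monotonicity
  in time the truncated one is a subsolution, which is enough.
\<close>

lemma dirichlet_green: "dirichlet (green A u n) \<le> 2 * (w u * green A u n u)"
proof -
  let ?g = "green A u n"
  have "(\<Sum>y\<in>UNIV. w y * ?g y * (?g y - mean ?g y)) \<le> (\<Sum>y\<in>UNIV. if y = u then w u * ?g u else 0)"
  proof (rule sum_mono)
    fix y
    show "w y * ?g y * (?g y - mean ?g y) \<le> (if y = u then w u * ?g u else 0)"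
    proof (cases "y \<in> A")
      case True
      then have "?g y = 0" by (cases n) auto
      then show ?thesis using w_pos green_nonneg by (simp add: less_imp_le)
    next
      case False
      then have "?g y - mean ?g y \<le> of_bool (y = u)" using green_mono[of A u n y] by simp
      then have "w y * ?g y * (?g y - mean ?g y) \<le> w y * ?g y * of_bool (y = u)"
        using w_pos green_nonneg by (intro mult_left_mono) (auto simp: less_imp_le)
      then show ?thesis by auto
    qed
  qed
  also have "\<dots> = w u * ?g u" by simp
  finally show ?thesis by (simp add: dirichlet_eq)
qed

text \<open>
  The Dirichlet principle: the difference of the two functions vanishes wherever the hitting
  probability fails to be harmonic, so they are orthogonal and the energies add up.
\<close>

lemma dirichlet_hit_lim:
  assumes "z \<in> G" shows "dirichlet (hit_lim G z) \<le> dirichlet (indicator G)"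
proof -
  let ?f = "hit_lim G z" and ?g = "indicator G :: 's \<Rightarrow> real"
  define h where "h = (\<lambda>y. ?g y - ?f y)"
  have zero: "w y * h y * (?f y - mean ?f y) = 0" for y
  proof (cases "y \<in> G \<and> y \<noteq> z")
    case True
    then show ?thesis by (simp add: hit_lim_harmonic)
  next
    case False
    then have "h y = 0" using assms hit_lim_self[of G z] hit_lim_outside[of y G z]
      by (cases "y = z") (auto simp: h_def indicator_def)
    then show ?thesis by simp
  qed
  have cross: "(\<Sum>u\<in>UNIV. \<Sum>v\<in>UNIV. w u * Q u v * ((?f u - ?f v) * (h u - h v))) = 0"
    unfolding energy_bilinear zero by simp
  have "dirichlet ?g = (\<Sum>u\<in>UNIV. \<Sum>v\<in>UNIV. w u * Q u v * (?f u - ?f v)\<^sup>2 + w u * Q u v * (h u - h v)\<^sup>2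
      + 2 * (w u * Q u v * ((?f u - ?f v) * (h u - h v))))"
    unfolding dirichlet_def h_def by (intro sum.cong refl) (simp add: power2_eq_square algebra_simps)
  also have "\<dots> = dirichlet ?f + dirichlet h"
    using cross by (simp add: dirichlet_def sum.distrib flip: sum_distrib_left)
  finally show ?thesis using dirichlet_nonneg[of h] by simp
qed

definition flow :: "'s set \<Rightarrow> real" where
  "flow U = (\<Sum>u\<in>U. \<Sum>v\<in>-U. w u * Q u v)"

lemma dirichlet_indicator: "dirichlet (indicator G) = 2 * flow G"
proof -
  have "dirichlet (indicator G) = 2 * (\<Sum>u\<in>UNIV. w u * indicator G u * (indicator G u - mean (indicator G) u))"
    by (rule dirichlet_eq)
  also have "(\<Sum>u\<in>UNIV. w u * indicator G u * (indicator G u - mean (indicator G) u)) =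
      (\<Sum>u\<in>G. w u * (1 - mean (indicator G) u))"
    by (rule sum.mono_neutral_cong_right) (auto simp: indicator_def)
  also have "\<dots> = flow G" unfolding flow_def
  proof (rule sum.cong[OF refl])
    fix u
    have "1 - mean (indicator G) u = mean (\<lambda>v. 1 - indicator G v) u" by (simp add: mean_diff mean_const)
    also have "\<dots> = (\<Sum>v\<in>-G. Q u v)"
      unfolding mean_def by (rule sum.mono_neutral_cong_right) (auto simp: indicator_def)
    finally show "w u * (1 - mean (indicator G) u) = (\<Sum>v\<in>-G. w u * Q u v)" by (simp add: sum_distrib_left)
  qed
  finally show ?thesis .
qed

text \<open>
  The single term is estimated by the sum of \<open>w y * (1 - survival A n y)\<close> over all \<open>y\<close> in \<open>U\<close>. This sum
  grows in each step by at most the flow out of \<open>U\<close>, since by balance the transitions inside \<open>U\<close> do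
  not increase it.
\<close>

lemma survival_lower:
  assumes "U \<inter> A = {}" "z \<in> U"
  shows "w z * (1 - survival A n z) \<le> real n * flow U"
proof -
  have "(\<Sum>y\<in>U. w y * (1 - survival A n y)) \<le> real n * flow U"
  proof (induction n)
    case 0
    have "survival A 0 y = 1" if "y \<in> U" for y using that assms by auto
    then show ?case by simp
  next
    case (Suc n)
    let ?d = "\<lambda>v. 1 - survival A n v"
    have d: "0 \<le> ?d v" "?d v \<le> 1" for v using survival_nonneg survival_le_1 by auto
    have "w y * (1 - survival A (Suc n) y) = (\<Sum>v\<in>U. w y * Q y v * ?d v) + (\<Sum>v\<in>-U. w y * Q y v * ?d v)"
      if "y \<in> U" for y
    proof -
      have "1 - survival A (Suc n) y = mean ?d y" using that assms by (auto simp: mean_diff mean_const)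
      also have "\<dots> = (\<Sum>v\<in>U. Q y v * ?d v) + (\<Sum>v\<in>-U. Q y v * ?d v)"
        unfolding mean_def using sum.subset_diff[of U UNIV "\<lambda>v. Q y v * ?d v"] by (simp add: Compl_eq_Diff_UNIV)
      finally show ?thesis by (simp add: distrib_left sum_distrib_left mult.assoc)
    qed
    then have "(\<Sum>y\<in>U. w y * (1 - survival A (Suc n) y)) =
        (\<Sum>y\<in>U. \<Sum>v\<in>U. w y * Q y v * ?d v) + (\<Sum>y\<in>U. \<Sum>v\<in>-U. w y * Q y v * ?d v)"
      by (simp add: sum.distrib)
    also have "(\<Sum>y\<in>U. \<Sum>v\<in>-U. w y * Q y v * ?d v) \<le> flow U"
      unfolding flow_def using d w_pos Q_nonneg by (intro sum_mono mult_left_le) (auto simp: less_imp_le)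
    also have "(\<Sum>y\<in>U. \<Sum>v\<in>U. w y * Q y v * ?d v) = (\<Sum>v\<in>U. \<Sum>y\<in>U. w v * Q v y * ?d v)"
      by (subst sum.swap) (simp add: balance)
    also have "\<dots> \<le> (\<Sum>v\<in>U. w v * ?d v)"
    proof (rule sum_mono)
      fix v
      have "(\<Sum>y\<in>U. Q v y) \<le> 1" using Q_sum[of v] Q_nonneg
        by (metis finite sum_mono2 subset_UNIV)
      then have "(w v * ?d v) * (\<Sum>y\<in>U. Q v y) \<le> w v * ?d v"
        using d[of v] w_pos[of v] by (intro mult_left_le) auto
      moreover have "(\<Sum>y\<in>U. w v * Q v y * ?d v) = (w v * ?d v) * (\<Sum>y\<in>U. Q v y)"
        unfolding sum_distrib_left by (intro sum.cong refl) (simp add: mult_ac)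
      ultimately show "(\<Sum>y\<in>U. w v * Q v y * ?d v) \<le> w v * ?d v" by simp
    qed
    also note Suc
    finally show ?case by (simp add: algebra_simps)
  qed
  moreover have "w z * (1 - survival A n z) \<le> (\<Sum>y\<in>U. w y * (1 - survival A n y))"
    using w_pos survival_le_1 assms
    by (intro member_le_sum[of z U "\<lambda>y. w y * (1 - survival A n y)"]) (auto simp: less_imp_le)
  ultimately show ?thesis by simp
qed

end

section \<open>Estimates at low temperature\<close>

text \<open>
  Up to an error \<open>e\<close> in the energies, the weight of a state and the conductance of an edge are those
  of the Gibbs measure at inverse temperature \<open>\<beta>\<close>.
\<close>

locale low_temperature = energy_landscape E K + reversible_matrix Q w
  for E :: "'s::finite \<Rightarrow> real" and K :: "'s \<Rightarrow> 's \<Rightarrow> bool"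
    and Q :: "'s \<Rightarrow> 's \<Rightarrow> real" and w :: "'s \<Rightarrow> real" +
  fixes \<beta> e :: real
  assumes beta_pos: "0 < \<beta>"
    and Q_pos_iff: "0 < Q u v \<longleftrightarrow> K u v"
    and w_lower: "exp (- \<beta> * (E u + e)) \<le> w u"
    and w_upper: "w u \<le> exp (- \<beta> * (E u - e))"
    and c_lower: "u \<noteq> v \<Longrightarrow> K u v \<Longrightarrow> exp (- \<beta> * (max (E u) (E v) + e)) \<le> w u * Q u v"
    and c_upper: "u \<noteq> v \<Longrightarrow> K u v \<Longrightarrow> w u * Q u v \<le> exp (- \<beta> * (max (E u) (E v) - e))"
begin

lemma card_ge_1: "1 \<le> (real CARD('s))"
  using zero_less_card_finite[where 'a = 's] by linarith

text \<open>
  Along a path of height \<open>h\<close> all conductances are at least \<open>exp (- \<beta> * (h + e))\<close>.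
\<close>

lemma difference_below:
  assumes "height a b \<le> h"
  shows "\<bar>f a - f b\<bar> \<le> (real CARD('s)) * sqrt (dirichlet f * exp (\<beta> * (h + e)))"
proof (rule path_difference[OF joined_below[OF assms]])
  fix u v assume uv: "u \<in> below h" "v \<in> below h" "K u v"
  show "\<bar>f u - f v\<bar> \<le> sqrt (dirichlet f * exp (\<beta> * (h + e)))"
  proof (cases "u = v")
    case True
    then show ?thesis using dirichlet_nonneg by simp
  next
    case False
    have "exp (- \<beta> * (h + e)) \<le> exp (- \<beta> * (max (E u) (E v) + e))" using uv beta_pos by simp
    also have "\<dots> \<le> w u * Q u v" using c_lower False uv by simp
    finally have "\<bar>f u - f v\<bar> \<le> sqrt (dirichlet f / exp (- \<beta> * (h + e)))"
      by (intro edge_difference) simp_all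
    also have "dirichlet f / exp (- \<beta> * (h + e)) = dirichlet f * exp (\<beta> * (h + e))"
      by (simp add: exp_minus divide_inverse)
    finally show ?thesis .
  qed
qed (simp add: dirichlet_nonneg)

text \<open>
  The Green function \<open>g\<close> vanishes on \<open>A\<close>, so \<open>g u\<close> is at most a path length times the square root of
  its Dirichlet form over a conductance. The form is bounded by a multiple of \<open>g u\<close> itself, and
  solving for \<open>g u\<close> gives the claim.
\<close>

lemma green_bound:
  assumes "y \<in> A" "height u y \<le> E u + D"
  shows "green A u T u \<le> 2 * (real CARD('s))\<^sup>2 * exp (\<beta> * (D + 2 * e))"
proof -
  define g where "g = green A u T u"
  have g0: "0 \<le> g" unfolding g_def by (rule green_nonneg)
  have "green A u T y = 0" using assms(1) by (cases T) auto
  then have "g \<le> (real CARD('s)) * sqrt (dirichlet (green A u T) * exp (\<beta> * (E u + D + e)))"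
    using difference_below[OF assms(2), of "green A u T"] by (simp add: g_def)
  also have "\<dots> \<le> (real CARD('s)) * sqrt (2 * (w u * g) * exp (\<beta> * (E u + D + e)))"
    using dirichlet_green[of A u T] by (intro mult_left_mono real_sqrt_le_mono mult_right_mono) (auto simp: g_def)
  also have "\<dots> \<le> (real CARD('s)) * sqrt (2 * (exp (- \<beta> * (E u - e)) * g) * exp (\<beta> * (E u + D + e)))"
    using w_upper[of u] g0 by (intro mult_left_mono real_sqrt_le_mono mult_right_mono) auto
  also have "2 * (exp (- \<beta> * (E u - e)) * g) * exp (\<beta> * (E u + D + e)) = g * (2 * exp (\<beta> * (D + 2 * e)))"
  proof -
    have "exp (- \<beta> * (E u - e)) * exp (\<beta> * (E u + D + e)) = exp (\<beta> * (D + 2 * e))"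
      unfolding exp_add[symmetric] by (simp add: algebra_simps)
    then show ?thesis by (simp add: mult_ac)
  qed
  finally have "g\<^sup>2 \<le> ((real CARD('s)) * sqrt (g * (2 * exp (\<beta> * (D + 2 * e)))))\<^sup>2"
    using g0 by (intro power_mono)
  also have "\<dots> = g * (2 * (real CARD('s))\<^sup>2 * exp (\<beta> * (D + 2 * e)))"
    using g0 by (simp add: power_mult_distrib)
  finally have "g * g \<le> g * (2 * (real CARD('s))\<^sup>2 * exp (\<beta> * (D + 2 * e)))" by (simp add: power2_eq_square)
  then show ?thesis unfolding g_def[symmetric] using g0
    by (cases "g = 0") auto
qed

lemma sum_survival_upper:
  assumes "\<And>u. \<exists>y\<in>A. height u y \<le> E u + D"
  shows "(\<Sum>k<T. survival A k r) \<le> 2 * (real CARD('s)) ^ 3 * exp (\<beta> * (D + 2 * e))"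
proof -
  have "(\<Sum>k<T. survival A k r) = (\<Sum>u\<in>UNIV. green A u T r)" by (simp add: sum_green)
  also have "\<dots> \<le> (\<Sum>u\<in>(UNIV::'s set). 2 * (real CARD('s))\<^sup>2 * exp (\<beta> * (D + 2 * e)))"
  proof (rule sum_mono)
    fix u
    obtain y where "y \<in> A" "height u y \<le> E u + D" using assms by blast
    then show "green A u T r \<le> 2 * (real CARD('s))\<^sup>2 * exp (\<beta> * (D + 2 * e))"
      by (intro order_trans[OF green_diagonal green_bound])
  qed
  also have "\<dots> = 2 * (real CARD('s)) ^ 3 * exp (\<beta> * (D + 2 * e))" by (simp add: power2_eq_square power3_eq_cube)
  finally show ?thesis .
qed

lemma flow_bound:
  assumes "\<And>u v. u \<in> U \<Longrightarrow> v \<notin> U \<Longrightarrow> K u v \<Longrightarrow> h \<le> max (E u) (E v)"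
  shows "flow U \<le> (real CARD('s))\<^sup>2 * exp (- \<beta> * (h - e))"
proof -
  have "w u * Q u v \<le> exp (- \<beta> * (h - e))" if "u \<in> U" "v \<in> - U" for u v
  proof (cases "K u v")
    case True
    have "u \<noteq> v" using that by auto
    then have "w u * Q u v \<le> exp (- \<beta> * (max (E u) (E v) - e))" using True by (rule c_upper)
    also have "\<dots> \<le> exp (- \<beta> * (h - e))" using assms[of u v] that True beta_pos by simp
    finally show ?thesis .
  next
    case False
    then have "Q u v = 0" using Q_pos_iff[of u v] Q_nonneg[of u v] by simp
    then show ?thesis by simp
  qed
  then have "flow U \<le> (\<Sum>u\<in>U. \<Sum>v\<in>-U. exp (- \<beta> * (h - e)))"
    unfolding flow_def by (intro sum_mono) auto
  also have "\<dots> = real (card U) * real (card (- U)) * exp (- \<beta> * (h - e))" by simp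
  also have "\<dots> \<le> (real CARD('s)) * (real CARD('s)) * exp (- \<beta> * (h - e))"
    by (intro mult_right_mono mult_mono) (auto simp: card_mono)
  finally show ?thesis by (simp add: power2_eq_square)
qed

text \<open>
  The indicator of the sublevel set is a competitor in the Dirichlet principle. Its energy is the
  flow out of this set, over edges of height at least \<open>h + \<delta>\<close>, while a path from \<open>y\<close> to \<open>z\<close> uses only edges of height at most \<open>h\<close>.
\<close>

lemma hit_bound:
  assumes "height y z \<le> h" "\<And>c. h < E c \<Longrightarrow> h + \<delta> \<le> E c"
  shows "1 - hit_lim (below h) z y \<le> (real CARD('s)) * sqrt (2 * (real CARD('s))\<^sup>2 * exp (- \<beta> * (\<delta> - 2 * e)))"
proof -
  let ?f = "hit_lim (below h) z"
  have zG: "z \<in> below h" using height_ge_right[of z y] assms(1) by simp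
  have "flow (below h) \<le> (real CARD('s))\<^sup>2 * exp (- \<beta> * (h + \<delta> - e))"
    by (rule flow_bound) (simp add: le_max_iff_disj not_le assms(2))
  then have d: "dirichlet ?f \<le> 2 * (real CARD('s))\<^sup>2 * exp (- \<beta> * (h + \<delta> - e))"
    using dirichlet_hit_lim[OF zG] dirichlet_indicator[of "below h"] by simp
  have "1 - ?f y \<le> \<bar>?f y - ?f z\<bar>" by (simp add: hit_lim_self)
  also have "\<dots> \<le> (real CARD('s)) * sqrt (dirichlet ?f * exp (\<beta> * (h + e)))" by (rule difference_below[OF assms(1)])
  also have "\<dots> \<le> (real CARD('s)) * sqrt (2 * (real CARD('s))\<^sup>2 * exp (- \<beta> * (h + \<delta> - e)) * exp (\<beta> * (h + e)))"
    using d by (intro mult_left_mono real_sqrt_le_mono mult_right_mono) auto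
  also have "2 * (real CARD('s))\<^sup>2 * exp (- \<beta> * (h + \<delta> - e)) * exp (\<beta> * (h + e)) = 2 * (real CARD('s))\<^sup>2 * exp (- \<beta> * (\<delta> - 2 * e))"
    unfolding mult.assoc exp_add[symmetric] by (simp add: algebra_simps)
  finally show ?thesis .
qed

text \<open>
  Until time about \<open>w z / (2 F)\<close>, where \<open>F\<close> bounds the flow out of \<open>U\<close>, the chain survives
  with probability at least \<open>1/2\<close>.
\<close>

lemma survival_mean_lower:
  assumes "U \<inter> A = {}" "z \<in> U" "\<And>u v. u \<in> U \<Longrightarrow> v \<notin> U \<Longrightarrow> K u v \<Longrightarrow> B \<le> max (E u) (E v)"
  shows "\<exists>T. exp (\<beta> * (B - E z - 2 * e)) / (4 * (real CARD('s))\<^sup>2) \<le> (\<Sum>k<T. survival A k z)"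
proof -
  define X where "X = exp (\<beta> * (B - E z - 2 * e)) / (2 * (real CARD('s))\<^sup>2)"
  define F where "F = (real CARD('s))\<^sup>2 * exp (- \<beta> * (B - e))"
  have n0: "0 < (real CARD('s))" using card_ge_1 by linarith
  have F0: "0 < F" unfolding F_def using n0 by simp
  have X0: "0 < X" unfolding X_def using n0 by simp
  have "2 * (X * F) = exp (\<beta> * (B - E z - 2 * e)) * exp (- \<beta> * (B - e))"
    unfolding X_def F_def using n0 by simp
  also have "\<dots> = exp (- \<beta> * (E z + e))" unfolding exp_add[symmetric] by (simp add: algebra_simps)
  also have "\<dots> \<le> w z" by (rule w_lower)
  finally have XF: "2 * (X * F) \<le> w z" .
  have fl: "flow U \<le> F" unfolding F_def by (rule flow_bound[OF assms(3)])
  have fl0: "0 \<le> flow U"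
    unfolding flow_def by (intro sum_nonneg) (simp add: w_pos Q_nonneg less_imp_le)
  define T where "T = nat \<lfloor>X\<rfloor>"
  have T: "real T \<le> X" "X \<le> real T + 1" unfolding T_def using X0 by linarith+
  have half: "1 / 2 \<le> survival A k z" if "k < Suc T" for k
  proof -
    have "w z * (1 - survival A k z) \<le> real k * flow U" by (rule survival_lower[OF assms(1,2)])
    also have "\<dots> \<le> X * F"
      by (rule mult_mono[OF _ fl]) (use that T X0 fl0 in auto)
    also have "\<dots> \<le> w z * (1 / 2)" using XF by simp
    finally have "1 - survival A k z \<le> 1 / 2" using w_pos[of z] by (simp only: mult_le_cancel_left_pos)
    then show ?thesis by simp
  qed
  have "exp (\<beta> * (B - E z - 2 * e)) / (4 * (real CARD('s))\<^sup>2) = X / 2" by (simp add: X_def)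
  also have "\<dots> \<le> (\<Sum>k<Suc T. 1 / 2)" using T by simp
  also have "\<dots> \<le> (\<Sum>k<Suc T. survival A k z)" by (rule sum_mono) (rule half, simp)
  finally show ?thesis by (rule exI[of _ "Suc T"])
qed

text \<open>
  The chain starting at \<open>s\<close> hits \<open>z\<close> before climbing above their saddle with probability at
  least \<open>1/2\<close>. On the way, until it enters the strict basin of \<open>z\<close>, it visits only states attracted by
  \<open>z\<close>, none of which is in \<open>A\<close>. After entering, it may leave the basin again, so the same argument is
  applied afresh from the entrance \<open>u\<close>, now with the saddle of \<open>u\<close> and \<open>z\<close>, above which one has to
  climb in order to leave the basin. This costs a second factor \<open>1/2\<close>.
\<close>

lemma survival_attracted:
  assumes hit: "\<And>y z. 1 / 2 \<le> hit_lim (below (height y z)) z y"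
    and A: "\<And>t. attracted_among M t z \<Longrightarrow> t \<notin> A" and s: "attracted_among M s z" and sub: "M \<subseteq> local_minima E K"
  shows "survival A k z \<le> 4 * survival A k s"
proof -
  have zM: "z \<in> M" using attracted_amongD(1)[OF s] .
  have zsv: "z \<in> strict_basin M z" by (rule local_minimum_in_strict_basin[OF sub zM])
  have step: "v \<in> {v. joined K (G - T) y0 v} \<or> v \<in> T \<or> v \<notin> G"
    if "y \<in> {v. joined K (G - T) y0 v}" "0 < Q y v" for y v y0 G T
  proof -
    have "K y v" using that(2) Q_pos_iff by simp
    then show ?thesis using that(1) joined_step[of K "G - T" y0 y v] by auto
  qed
  (* From the basin of z, the component below the saddle of u and z stays in the basin. *)
  have inner: "1 / 2 * survival A k z \<le> survival A k u" if u: "u \<in> strict_basin M z" for u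
  proof (cases "u = z")
    case True
    then show ?thesis using survival_nonneg[of A k z] by simp
  next
    case False
    let ?G = "below (height u z)"
    let ?C = "{v. joined K (?G - {z}) u v}"
    have "v \<notin> A" "v \<noteq> z" if v: "v \<in> ?C" for v
    proof -
      have "joined K ?G u v" by (rule joined_mono[of K "?G - {z}"]) (use v in auto)
      then have "v \<in> strict_basin M z" using strict_basin_closed[OF u] height_le by simp
      then show "v \<notin> A" using A strict_basin_attracted zM by simp
      show "v \<noteq> z" using joined_right[of K "?G - {z}" u v] v by auto
    qed
    then have CA: "?C \<inter> A = {}" "?C \<inter> {z} = {}" by auto
    have "u \<in> ?C" using False height_ge_left[of u z] by simp
    from survival_transfer[of z "{z}" 1 A k ?C ?G u, OF _ _ _ _ CA step[of _ "?G" "{z}" u] this]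
    have "hit_lim ?G z u * survival A k z \<le> survival A k u" by simp
    moreover have "1 / 2 * survival A k z \<le> hit_lim ?G z u * survival A k z"
      using hit survival_nonneg by (intro mult_right_mono)
    ultimately show ?thesis by linarith
  qed
  show ?thesis
  proof (cases "s \<in> strict_basin M z")
    case True
    then show ?thesis using inner[of s] survival_nonneg[of A k s] by simp
  next
    case False
    let ?G = "below (height s z)" and ?T = "strict_basin M z"
    let ?C = "{v. joined K (?G - ?T) s v}"
    have "v \<notin> A" "v \<notin> ?T" if v: "v \<in> ?C" for v
      using A attracted_among_component[OF s] joined_right[of K "?G - ?T" s v] v by auto
    then have CA: "?C \<inter> A = {}" "?C \<inter> ?T = {}" by auto
    have "s \<in> ?C" using False height_ge_left[of s z] by simp
    from survival_transfer[of z ?T "1/2" A k ?C ?G s, OF zsv inner _ _ CA step[of _ "?G" "?T" s] this]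
    have "1 / 2 * hit_lim ?G z s * survival A k z \<le> survival A k s" by simp
    moreover have "1 / 2 * (1 / 2) * survival A k z \<le> 1 / 2 * hit_lim ?G z s * survival A k z"
      using hit[of s z] survival_nonneg by (intro mult_right_mono) auto
    ultimately show ?thesis by linarith
  qed
qed

end

context ranked_landscape
begin

text \<open>
  The form in which a family of survival probabilities enters: being attracted costs at most a factor
  4. Stating it for arbitrary \<open>F\<close> makes the resulting constants independent of the temperature.
\<close>

definition attraction_stable :: "nat \<Rightarrow> (nat \<Rightarrow> 's \<Rightarrow> real) \<Rightarrow> bool" where
  "attraction_stable i F \<longleftrightarrow>
     (\<forall>k t z T. 1 \<le> k \<longrightarrow> k \<le> i \<longrightarrow> attracted_among (M k) t z \<longrightarrow> F T z \<le> 4 * F T t)"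

text \<open>
  The factor 4 is lost once for the first attraction and once for every merger on the chain.
\<close>

lemma valley_dominates:
  assumes "1 \<le> i" "i \<le> j" "j \<le> nn" "s \<in> V i (m j)"
  shows "\<exists>c>0. \<forall>F. attraction_stable i F \<longrightarrow> (\<forall>T. c * F T (m j) \<le> F T s)"
proof -
  obtain l b where lb: "l \<le> i" "first_attraction s l b" "(parent i)\<^sup>*\<^sup>* b j"
    using valley_chain[OF assms] by blast
  from lb(3) have "\<exists>c>0. \<forall>F. attraction_stable i F \<longrightarrow> (\<forall>T. c * F T (m j) \<le> F T s)"
  proof (induction rule: rtranclp_induct)
    case base
    have "F T (m b) \<le> 4 * F T s" if "attraction_stable i F" for F T
      using that first_attractionD(1,4)[OF lb(2)] lb(1) unfolding attraction_stable_def by blast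
    then have "\<forall>F. attraction_stable i F \<longrightarrow> (\<forall>T. 1 / 4 * F T (m b) \<le> F T s)"
      by (simp add: field_simps)
    then show ?case by (intro exI[of _ "1/4"]) simp
  next
    case (step c d)
    then obtain q where q: "0 < q" "\<And>F T. attraction_stable i F \<Longrightarrow> q * F T (m c) \<le> F T s" by blast
    obtain l where l: "1 \<le> c" "c < l" "l \<le> i" "attracted_among (M l) (m c) (m d)"
      using step.hyps(2) by (rule parentE)
    then have "1 \<le> l" by simp
    have "q / 4 * F T (m d) \<le> F T s" if "attraction_stable i F" for F T
    proof -
      have "F T (m d) \<le> 4 * F T (m c)"
        using that \<open>1 \<le> l\<close> l(3,4) unfolding attraction_stable_def by blast
      then have "q * F T (m d) \<le> q * (4 * F T (m c))" using q(1) by simp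
      then show ?thesis using q(2)[OF that, of T] by simp
    qed
    then show ?case using q(1) by (intro exI[of _ "q/4"]) simp
  qed
  then show ?thesis .
qed

end

locale low_temperature_ranked = ranked_landscape E K m + low_temperature E K Q w \<beta> e
  for E :: "'s::finite \<Rightarrow> real" and K :: "'s \<Rightarrow> 's \<Rightarrow> bool" and m :: "nat \<Rightarrow> 's"
    and Q :: "'s \<Rightarrow> 's \<Rightarrow> real" and w :: "'s \<Rightarrow> real" and \<beta> e :: real
begin

text \<open>
  The other metastable states can be reached from the valley only through \<open>N i\<close>. So adding them to
  the target does not change the exit time, but it makes the target reachable from everywhere by
  climbing at most \<open>barrier i x - E x\<close>.
\<close>

lemma exit_sum_upper:
  assumes "1 \<le> i" "i < nn" "x \<in> M i" "r \<in> V i x"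
  shows "(\<Sum>k<T. survival (N i) k r) \<le> 2 * (real CARD('s)) ^ 3 * exp (\<beta> * (barrier i x - E x + 2 * e))"
proof -
  obtain j where j: "i \<le> j" "j \<le> nn" "x = m j" using M_E[of i x] assms by auto
  let ?A = "N i \<union> (M i - {x})"
  have notA: "V i x \<inter> (N i \<union> ?A) = {}"
  proof -
    have "y \<notin> N i" if "y \<in> V i x" for y
      using V_not_N[of y i j i] that j assms by auto
    moreover have "y \<notin> V i x" if y: "y \<in> M i" "y \<noteq> x" for y
    proof -
      obtain j' where j': "i \<le> j'" "j' \<le> nn" "y = m j'" using M_E[of i y] y assms by auto
      then show ?thesis using m_in_V_unique[of i j j'] j y assms by auto
    qed
    ultimately show ?thesis by auto
  qed
  have "survival (N i) k r = survival ?A k r" for k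
  proof (rule survival_cong_closed[OF _ notA assms(4)])
    fix y v assume "y \<in> V i x" "0 < Q y v"
    then show "v \<in> V i x \<or> v \<in> N i \<inter> ?A"
      using V_closed[of i j y v] Q_pos_iff j assms by auto
  qed
  then have "(\<Sum>k<T. survival (N i) k r) = (\<Sum>k<T. survival ?A k r)" by simp
  also have "\<dots> \<le> 2 * (real CARD('s)) ^ 3 * exp (\<beta> * (barrier i x - E x + 2 * e))"
    by (rule sum_survival_upper) (use depth[OF assms(1-3)] in blast)
  finally show ?thesis .
qed

lemma exit_sum_lower_bottom:
  assumes "1 \<le> i" "i < nn" "x \<in> M i"
  shows "\<exists>T. exp (\<beta> * (barrier i x - E x - 2 * e)) / (4 * (real CARD('s))\<^sup>2) \<le> (\<Sum>k<T. survival (N i) k x)"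
proof (rule survival_mean_lower[of "strict_basin (M i) x"])
  show "strict_basin (M i) x \<inter> N i = {}" using attracted_among_not_N[OF strict_basin_attracted] assms by auto
  show "x \<in> strict_basin (M i) x" using local_minimum_in_strict_basin M_local_minima assms by simp
  fix u v assume uv: "u \<in> strict_basin (M i) x" "v \<notin> strict_basin (M i) x" "K u v"
  show "barrier i x \<le> max (E u) (E v)"
  proof (rule ccontr)
    assume lt: "\<not> ?thesis"
    then have "height v u < barrier i x"
      using height_edge[OF K_sym[OF uv(3)]] by linarith
    moreover have "height u x < barrier i x"
      using uv(1) in_strict_basin_iff_barrier[OF assms(1,2)] by blast
    moreover have "height v x \<le> max (height v u) (height u x)"
      by (rule height_ultra[of v u, OF max.cobounded1 max.cobounded2])
    ultimately have "height v x < barrier i x" by linarith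
    then show False using uv(2) in_strict_basin_iff_barrier[OF assms(1,2)] by blast
  qed
qed

lemma survival_attracted_level:
  assumes hit: "\<And>y z. 1 / 2 \<le> hit_lim (below (height y z)) z y"
    and "i \<le> nn" "1 \<le> k" "k \<le> i" "attracted_among (M k) t z"
  shows "survival (N i) T z \<le> 4 * survival (N i) T t"
proof (rule survival_attracted[OF hit _ assms(5) M_local_minima[OF assms(3)]])
  fix t assume "attracted_among (M k) t z"
  then have "t \<notin> N k" by (rule attracted_among_not_N) (use assms(2-4) in simp_all)
  then show "t \<notin> N i" using N_antimono[OF assms(3,4)] by blast
qed

lemma exit_sum_lower:
  assumes hit: "\<And>y z. 1 / 2 \<le> hit_lim (below (height y z)) z y"
    and i: "1 \<le> i" "i < nn" "x \<in> M i" and c: "0 < c"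
    and dominates: "\<And>F. attraction_stable i F \<Longrightarrow> \<forall>T. c * F T x \<le> F T r"
  shows "\<exists>T. c / (4 * (real CARD('s))\<^sup>2) * exp (\<beta> * (barrier i x - E x - 2 * e)) \<le> (\<Sum>k<T. survival (N i) k r)"
proof -
  obtain T where T: "exp (\<beta> * (barrier i x - E x - 2 * e)) / (4 * (real CARD('s))\<^sup>2) \<le> (\<Sum>k<T. survival (N i) k x)"
    using exit_sum_lower_bottom[OF i] by blast
  have "attraction_stable i (survival (N i))"
    unfolding attraction_stable_def using survival_attracted_level[OF hit] i(2) by simp
  then have dom: "c * survival (N i) k x \<le> survival (N i) k r" for k
    using dominates by simp
  have "c * (exp (\<beta> * (barrier i x - E x - 2 * e)) / (4 * (real CARD('s))\<^sup>2)) \<le> c * (\<Sum>k<T. survival (N i) k x)"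
    using T c by (intro mult_left_mono) auto
  also have "\<dots> \<le> (\<Sum>k<T. survival (N i) k r)"
    unfolding sum_distrib_left by (intro sum_mono dom)
  finally show ?thesis by (intro exI[of _ T]) simp
qed

end

section \<open>The exponential limit\<close>

text \<open>
  Constant factors disappear on the exponential scale.
\<close>

lemma log_limit:
  fixes X :: "real \<Rightarrow> ennreal" and D c1 c2 :: real
  assumes a: "(a \<longlongrightarrow> 0) at_top" and c: "0 < c1" "0 < c2"
    and lower: "eventually (\<lambda>\<beta>. ennreal (c1 * exp (\<beta> * (D - a \<beta>))) \<le> X \<beta>) at_top"
    and upper: "eventually (\<lambda>\<beta>. X \<beta> \<le> ennreal (c2 * exp (\<beta> * (D + a \<beta>)))) at_top"
  shows "((\<lambda>\<beta>. ereal (1 / \<beta>) * ln_ennreal (X \<beta>)) \<longlongrightarrow> ereal D) at_top"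
proof -
  define g where "g \<beta> = ln (enn2real (X \<beta>)) / \<beta>" for \<beta>
  have *: "ereal (1 / \<beta>) * ln_ennreal (X \<beta>) = ereal (g \<beta>) \<and>
      ln c1 / \<beta> + (D - a \<beta>) \<le> g \<beta> \<and> g \<beta> \<le> ln c2 / \<beta> + (D + a \<beta>)"
    if \<beta>: "0 < \<beta>" and l: "ennreal (c1 * exp (\<beta> * (D - a \<beta>))) \<le> X \<beta>"
      and u: "X \<beta> \<le> ennreal (c2 * exp (\<beta> * (D + a \<beta>)))" for \<beta>
  proof -
    have fin: "X \<beta> < top" using u ennreal_less_top order_le_less_trans by blast
    define y where "y = enn2real (X \<beta>)"
    have X: "X \<beta> = ennreal y" "0 \<le> y" using fin by (auto simp: y_def)
    have y: "c1 * exp (\<beta> * (D - a \<beta>)) \<le> y" "y \<le> c2 * exp (\<beta> * (D + a \<beta>))"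
      using l u X c by (auto simp: ennreal_le_iff)
    have y0: "0 < y" using y(1) c(1) by (meson exp_gt_zero mult_pos_pos order_less_le_trans)
    have "ln (c1 * exp (\<beta> * (D - a \<beta>))) \<le> ln y" using y(1) y0 c by (subst ln_le_cancel_iff) auto
    then have 1: "ln c1 + \<beta> * (D - a \<beta>) \<le> ln y" using c by (simp add: ln_mult)
    have "ln y \<le> ln (c2 * exp (\<beta> * (D + a \<beta>)))" using y(2) y0 c by (subst ln_le_cancel_iff) auto
    then have 2: "ln y \<le> ln c2 + \<beta> * (D + a \<beta>)" using c by (simp add: ln_mult)
    have "ln_ennreal (X \<beta>) = ereal (ln y)" using X y0 by (simp add: ln_ennreal_def)
    moreover have "(ln c1 + \<beta> * (D - a \<beta>)) / \<beta> \<le> ln y / \<beta>" "ln y / \<beta> \<le> (ln c2 + \<beta> * (D + a \<beta>)) / \<beta>"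
      using 1 2 \<beta> by (intro divide_right_mono; simp)+
    ultimately show ?thesis using \<beta> unfolding g_def y_def[symmetric] by (simp add: add_divide_distrib)
  qed
  have ev: "eventually (\<lambda>\<beta>. ereal (1 / \<beta>) * ln_ennreal (X \<beta>) = ereal (g \<beta>) \<and>
      ln c1 / \<beta> + (D - a \<beta>) \<le> g \<beta> \<and> g \<beta> \<le> ln c2 / \<beta> + (D + a \<beta>)) at_top"
    using eventually_gt_at_top[of 0] lower upper by eventually_elim (rule *)
  have lim: "((\<lambda>\<beta>. q / \<beta>) \<longlongrightarrow> 0) at_top" for q :: real
    by (rule tendsto_divide_0[OF tendsto_const filterlim_at_top_imp_at_infinity[OF filterlim_ident]])
  have l1: "((\<lambda>\<beta>. ln c1 / \<beta> + (D - a \<beta>)) \<longlongrightarrow> 0 + (D - 0)) at_top"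
    by (intro tendsto_intros lim a)
  have l2: "((\<lambda>\<beta>. ln c2 / \<beta> + (D + a \<beta>)) \<longlongrightarrow> 0 + (D + 0)) at_top"
    by (intro tendsto_intros lim a)
  have "(g \<longlongrightarrow> D) at_top"
  proof (rule tendsto_sandwich)
    show "\<forall>\<^sub>F \<beta> in at_top. ln c1 / \<beta> + (D - a \<beta>) \<le> g \<beta>"
      using ev by (rule eventually_mono) simp
    show "\<forall>\<^sub>F \<beta> in at_top. g \<beta> \<le> ln c2 / \<beta> + (D + a \<beta>)"
      using ev by (rule eventually_mono) simp
  qed (use l1 l2 in simp_all)
  then have "((\<lambda>\<beta>. ereal (g \<beta>)) \<longlongrightarrow> ereal D) at_top" by (intro tendsto_intros)
  then show ?thesis
  proof (rule Lim_transform_eventually)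
    show "\<forall>\<^sub>F \<beta> in at_top. ereal (g \<beta>) = ereal (1 / \<beta>) * ln_ennreal (X \<beta>)"
      using ev by (rule eventually_mono) simp
  qed
qed

context metastable_chain
begin

lemma landscape: "energy_landscape E K"
proof
  show "inj E" by (rule E_inj)
  show "K b a" if "K a b" for a b
    using that pos_sym[of 1 a b] pos_iff[of 1 a b] pos_iff[of 1 b a] by simp
  have "(\<lambda>a b. 0 < p 1 a b) = K" by (intro ext) (simp add: pos_iff)
  then show "K\<^sup>*\<^sup>* a b" for a b
    using irreducible[of 1] by (simp add: irreducible_matrix_def)
qed

lemma pi_pos:
  assumes "0 < \<beta>" shows "0 < \<pi> \<beta> s"
proof -
  interpret energy_landscape E K by (rule landscape)
  have st: "0 \<le> \<pi> \<beta> s" "(\<Sum>s\<in>UNIV. \<pi> \<beta> s) = 1" for s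
    using stationary[OF assms] by (auto simp: stationary_distribution_def)
  then obtain z where "\<pi> \<beta> z \<noteq> 0" by (metis sum.neutral zero_neq_one)
  then have z: "0 < \<pi> \<beta> z" using st(1)[of z] by simp
  show ?thesis using joined_UNIV[of z s]
  proof (induction rule: joined_induct)
    case refl
    then show ?case using z by simp
  next
    case (step b c)
    have "0 < \<pi> \<beta> b * p \<beta> b c" using step pos_iff[OF assms] by simp
    then have "0 < \<pi> \<beta> c * p \<beta> c b" using reversible[OF assms] by simp
    then show ?case using st(1)[of c] by (metis less_eq_real_def mult_zero_left)
  qed
qed

text \<open>
  By detailed balance and the bounds on \<open>p\<close>, the function \<open>ln (\<pi> \<beta> u) + \<beta> * E u\<close> changes by at most
  \<open>2 * \<beta> * \<gamma> \<beta> / card UNIV\<close> along an edge, hence by at most \<open>2 * \<beta> * \<gamma> \<beta>\<close> altogether. The weight \<open>w\<close> is \<open>\<pi> \<beta>\<close>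
  normalised at one state; one further \<open>\<gamma> \<beta>\<close> is spent on the transition probability in the conductances.
\<close>

lemma gibbs:
  assumes \<beta>: "0 < \<beta>"
  shows "\<exists>w. low_temperature E K (p \<beta>) w \<beta> (3 * \<gamma> \<beta>)"
proof -
  interpret energy_landscape E K by (rule landscape)
  define C where "C = real CARD('s)"
  define q where "q = \<gamma> \<beta> / C"
  have C1: "1 \<le> C" using zero_less_card_finite[where 'a = 's] unfolding C_def by linarith
  have q0: "0 \<le> q" "q \<le> \<gamma> \<beta>" using gamma_pos[OF \<beta>] C1 by (auto simp: q_def field_simps)
  (* Constant for an exact Gibbs measure; its oscillation measures the deviation from it. *)
  define f where "f u = ln (\<pi> \<beta> u) + \<beta> * E u" for u
  define P where "P u v = max 0 (E v - E u)" for u v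
  have p_pos: "0 < p \<beta> u v" if "K u v" for u v using pos_iff[OF \<beta>] that by simp
  have lnp: "- \<beta> * (P u v + q) \<le> ln (p \<beta> u v)" "ln (p \<beta> u v) \<le> - \<beta> * (P u v - q)"
    if "K u v" "u \<noteq> v" for u v
  proof -
    have "exp (- \<beta> * (P u v + q)) \<le> exp (ln (p \<beta> u v))" "exp (ln (p \<beta> u v)) \<le> exp (- \<beta> * (P u v - q))"
      using p_lower[OF \<beta> that(2,1)] p_upper[OF \<beta> that(2,1)] p_pos[OF that(1)] unfolding P_def q_def C_def by auto
    then show "- \<beta> * (P u v + q) \<le> ln (p \<beta> u v)" "ln (p \<beta> u v) \<le> - \<beta> * (P u v - q)" by simp_all
  qed
  have edge: "\<bar>f u - f v\<bar> \<le> 2 * \<beta> * q" if uv: "K u v" for u v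
  proof (cases "u = v")
    case True
    then show ?thesis using q0 \<beta> by simp
  next
    case False
    have vu: "K v u" using K_sym uv by blast
    have "ln (\<pi> \<beta> u * p \<beta> u v) = ln (\<pi> \<beta> v * p \<beta> v u)" using reversible[OF \<beta>] by simp
    then have "ln (\<pi> \<beta> u) + ln (p \<beta> u v) = ln (\<pi> \<beta> v) + ln (p \<beta> v u)"
      using pi_pos[OF \<beta>, of u] pi_pos[OF \<beta>, of v] p_pos[OF uv] p_pos[OF vu]
      by (simp add: ln_mult)
    moreover have "P u v = P v u + (E v - E u)" by (simp add: P_def)
    then have "\<beta> * P u v = \<beta> * P v u + \<beta> * E v - \<beta> * E u"
      by (simp only: distrib_left right_diff_distrib)
    ultimately show ?thesis
      using lnp[OF uv False] lnp[OF vu] False unfolding f_def abs_le_iff by (auto simp: algebra_simps)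
  qed
  obtain z :: 's where True by simp
  have fz: "\<bar>f u - f z\<bar> \<le> 2 * \<beta> * \<gamma> \<beta>" for u
  proof -
    have "\<bar>f u - f z\<bar> \<le> C * (2 * \<beta> * q)"
      unfolding C_def by (rule path_difference[OF joined_UNIV edge]) (use q0 \<beta> in auto)
    then show ?thesis using C1 by (simp add: q_def)
  qed
  (* This normalisation makes the weight of z equal to its Boltzmann factor. *)
  define w where "w u = \<pi> \<beta> u / exp (f z)" for u
  have w_eq: "w u = exp (f u - f z - \<beta> * E u)" for u
  proof -
    have "w u = exp (ln (\<pi> \<beta> u)) / exp (f z)"
      using pi_pos[OF \<beta>, of u] by (simp add: w_def)
    also have "\<dots> = exp (ln (\<pi> \<beta> u) - f z)" by (simp only: exp_diff)
    also have "ln (\<pi> \<beta> u) - f z = f u - f z - \<beta> * E u" by (simp add: f_def)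
    finally show ?thesis .
  qed
  have bg: "0 \<le> \<beta> * \<gamma> \<beta>" using \<beta> gamma_pos[OF \<beta>] by simp
  have wb: "exp (- (2 * \<beta> * \<gamma> \<beta>) - \<beta> * E u) \<le> w u" "w u \<le> exp (2 * \<beta> * \<gamma> \<beta> - \<beta> * E u)" for u
    unfolding w_eq using fz[of u] by (auto simp: abs_le_iff)
  have mx: "max (E u) (E v) = E u + P u v" for u v by (simp add: P_def)
  have pq: "exp (- \<beta> * (P u v + \<gamma> \<beta>)) \<le> p \<beta> u v" "p \<beta> u v \<le> exp (- \<beta> * (P u v - \<gamma> \<beta>))"
    if "u \<noteq> v" "K u v" for u v
  proof -
    have "exp (- \<beta> * (P u v + \<gamma> \<beta>)) \<le> exp (- \<beta> * (P u v + q))" using q0 \<beta> by simp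
    also have "\<dots> \<le> p \<beta> u v" using p_lower[OF \<beta> that] unfolding P_def q_def C_def .
    finally show "exp (- \<beta> * (P u v + \<gamma> \<beta>)) \<le> p \<beta> u v" .
    have "p \<beta> u v \<le> exp (- \<beta> * (P u v - q))" using p_upper[OF \<beta> that] unfolding P_def q_def C_def .
    also have "\<dots> \<le> exp (- \<beta> * (P u v - \<gamma> \<beta>))" using q0 \<beta> by simp
    finally show "p \<beta> u v \<le> exp (- \<beta> * (P u v - \<gamma> \<beta>))" .
  qed
  have "low_temperature E K (p \<beta>) w \<beta> (3 * \<gamma> \<beta>)"
  proof
    show "0 \<le> p \<beta> r s" for r s using transition[OF \<beta>] by (simp add: transition_matrix_def)
    show "(\<Sum>s\<in>UNIV. p \<beta> r s) = 1" for r using transition[OF \<beta>] by (simp add: transition_matrix_def)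
    show "0 < w r" for r by (simp add: w_eq)
    show "w r * p \<beta> r s = w s * p \<beta> s r" for r s using reversible[OF \<beta>, of r s] by (simp add: w_def)
    show "0 < \<beta>" by (rule \<beta>)
    show "0 < p \<beta> u v \<longleftrightarrow> K u v" for u v by (rule pos_iff[OF \<beta>])
    fix u v
    have "exp (- \<beta> * (E u + 3 * \<gamma> \<beta>)) \<le> exp (- (2 * \<beta> * \<gamma> \<beta>) - \<beta> * E u)"
      using bg by (simp add: algebra_simps)
    then show "exp (- \<beta> * (E u + 3 * \<gamma> \<beta>)) \<le> w u" using wb(1)[of u] by linarith
    have "exp (2 * \<beta> * \<gamma> \<beta> - \<beta> * E u) \<le> exp (- \<beta> * (E u - 3 * \<gamma> \<beta>))"
      using bg by (simp add: algebra_simps)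
    then show "w u \<le> exp (- \<beta> * (E u - 3 * \<gamma> \<beta>))" using wb(2)[of u] by linarith
    assume uv: "u \<noteq> v" "K u v"
    have "exp (- \<beta> * (max (E u) (E v) + 3 * \<gamma> \<beta>)) =
        exp (- (2 * \<beta> * \<gamma> \<beta>) - \<beta> * E u) * exp (- \<beta> * (P u v + \<gamma> \<beta>))"
      unfolding mx exp_add[symmetric] by (simp add: algebra_simps)
    also have "\<dots> \<le> w u * p \<beta> u v" by (intro mult_mono wb pq uv) (auto simp: w_eq)
    finally show "exp (- \<beta> * (max (E u) (E v) + 3 * \<gamma> \<beta>)) \<le> w u * p \<beta> u v" .
    have "w u * p \<beta> u v \<le> exp (2 * \<beta> * \<gamma> \<beta> - \<beta> * E u) * exp (- \<beta> * (P u v - \<gamma> \<beta>))"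
      using p_pos[OF uv(2)] by (intro mult_mono wb pq uv) auto
    also have "\<dots> = exp (- \<beta> * (max (E u) (E v) - 3 * \<gamma> \<beta>))"
      unfolding mx exp_add[symmetric] by (simp add: algebra_simps)
    finally show "w u * p \<beta> u v \<le> exp (- \<beta> * (max (E u) (E v) - 3 * \<gamma> \<beta>))" .
  qed
  then show ?thesis by blast
qed

lemma hit_error_eventually:
  assumes "0 < \<delta>"
  shows "eventually (\<lambda>\<beta>. c * sqrt (d * exp (- \<beta> * (\<delta> - 2 * (3 * \<gamma> \<beta>)))) \<le> 1 / 2) at_top"
proof -
  have "((\<lambda>\<beta>. \<delta> - 2 * (3 * \<gamma> \<beta>)) \<longlongrightarrow> \<delta> - 2 * (3 * 0)) at_top"
    by (intro tendsto_intros gamma_lim)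
  then have "((\<lambda>\<beta>. \<delta> - 2 * (3 * \<gamma> \<beta>)) \<longlongrightarrow> \<delta>) at_top" by simp
  then have "filterlim (\<lambda>\<beta>. (\<delta> - 2 * (3 * \<gamma> \<beta>)) * \<beta>) at_top at_top"
    using assms by (rule filterlim_tendsto_pos_mult_at_top) (rule filterlim_ident)
  then have "filterlim (\<lambda>\<beta>. - \<beta> * (\<delta> - 2 * (3 * \<gamma> \<beta>))) at_bot at_top"
    by (simp add: filterlim_uminus_at_top mult.commute)
  then have "((\<lambda>\<beta>. exp (- \<beta> * (\<delta> - 2 * (3 * \<gamma> \<beta>)))) \<longlongrightarrow> 0) at_top"
    by (rule filterlim_compose[OF exp_at_bot])
  then have "((\<lambda>\<beta>. c * sqrt (d * exp (- \<beta> * (\<delta> - 2 * (3 * \<gamma> \<beta>))))) \<longlongrightarrow> c * sqrt (d * 0)) at_top"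
    by (intro tendsto_intros)
  then have "eventually (\<lambda>\<beta>. c * sqrt (d * exp (- \<beta> * (\<delta> - 2 * (3 * \<gamma> \<beta>)))) < 1 / 2) at_top"
    by (rule order_tendstoD) simp
  then show ?thesis by (rule eventually_mono) simp
qed

end

theorem theorem2p12:
  fixes E :: "'s::finite \<Rightarrow> real"
    and K :: "'s \<Rightarrow> 's \<Rightarrow> bool"
    and p :: "real \<Rightarrow> 's \<Rightarrow> 's \<Rightarrow> real"
    and pstar :: "'s \<Rightarrow> 's \<Rightarrow> real"
    and \<pi> :: "real \<Rightarrow> 's \<Rightarrow> real"
    and \<gamma> :: "real \<Rightarrow> real"
    and P :: "real \<Rightarrow> 's \<Rightarrow> 'w measure"
    and X :: "real \<Rightarrow> nat \<Rightarrow> 'w \<Rightarrow> 's"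
    and m :: "nat \<Rightarrow> 's" and i :: nat and x r :: 's
  assumes "metastable_chain E K p pstar \<pi> \<gamma>"
    and "\<And>\<beta> y. 0 < \<beta> \<Longrightarrow> markov_chain_from (P \<beta> y) (X \<beta>) (p \<beta>) y"
    and "meta_enumeration E K m"
    and "1 \<le> i" and "i < n_meta E K"
    and "x \<in> meta_states E K m i"
    and "r \<in> valley E K m i x"
  shows "((\<lambda>\<beta>. ereal (1 / \<beta>) * ln_ennreal (expected_zeta0 (P \<beta> r) (non_assigned E K m i) (X \<beta>)))
           \<longlongrightarrow> ereal (E (exit_state E K m i x) - E x)) at_top"
proof -
  interpret chain: metastable_chain E K p pstar \<pi> \<gamma> by (rule assms(1))
  interpret energy_landscape E K by (rule chain.landscape)
  interpret ranked_landscape E K m by unfold_locales (rule assms(3))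
  define C where "C = real CARD('s)"
  have C0: "0 < C" unfolding C_def using zero_less_card_finite[where 'a = 's] by simp
  define D where "D = barrier i x - E x"
  obtain j where j: "i \<le> j" "j \<le> nn" "x = m j" using M_E[of i x] assms(4-6) by auto
  have r_not: "r \<notin> N i" using V_not_N[of r i j i] j assms(4,7) by simp
  obtain c where c: "0 < c" "\<And>F. attraction_stable i F \<Longrightarrow> \<forall>T. c * F T x \<le> F T r"
    using valley_dominates[of i j r] j assms(4,7) by auto
  obtain \<delta> where \<delta>: "0 < \<delta>" "\<And>a b. E a < E b \<Longrightarrow> E a + \<delta> \<le> E b" using energy_gap by blast
  (* The factor 6 is twice the error 3 * gamma in the weights and the conductances. *)
  have upper: "expected_zeta0 (P \<beta> r) (N i) (X \<beta>) \<le> ennreal (2 * C ^ 3 * exp (\<beta> * (D + 6 * \<gamma> \<beta>)))"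
    and lower: "C * sqrt (2 * C\<^sup>2 * exp (- \<beta> * (\<delta> - 2 * (3 * \<gamma> \<beta>)))) \<le> 1 / 2 \<Longrightarrow>
      ennreal (c / (4 * C\<^sup>2) * exp (\<beta> * (D - 6 * \<gamma> \<beta>))) \<le> expected_zeta0 (P \<beta> r) (N i) (X \<beta>)"
    if \<beta>: "0 < \<beta>" for \<beta>
  proof -
    obtain w where w: "low_temperature E K (p \<beta>) w \<beta> (3 * \<gamma> \<beta>)" using chain.gibbs[OF \<beta>] by blast
    interpret low_temperature E K "p \<beta>" w \<beta> "3 * \<gamma> \<beta>" by (rule w)
    interpret low_temperature_ranked E K m "p \<beta>" w \<beta> "3 * \<gamma> \<beta>" ..
    have exp_eq: "expected_zeta0 (P \<beta> r) (N i) (X \<beta>) = (\<Sum>k. ennreal (survival (N i) k r))"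
      by (rule expected_zeta0_eq[OF assms(2)[OF \<beta>] r_not])
    have part: "(\<Sum>k<T. ennreal (survival (N i) k r)) = ennreal (\<Sum>k<T. survival (N i) k r)" for T
      by (simp add: sum_ennreal survival_nonneg)
    show "expected_zeta0 (P \<beta> r) (N i) (X \<beta>) \<le> ennreal (2 * C ^ 3 * exp (\<beta> * (D + 6 * \<gamma> \<beta>)))"
      unfolding exp_eq suminf_eq_SUP part
    proof (intro SUP_least ennreal_leI)
      fix T
      show "(\<Sum>k<T. survival (N i) k r) \<le> 2 * C ^ 3 * exp (\<beta> * (D + 6 * \<gamma> \<beta>))"
        using exit_sum_upper[OF assms(4-7), of T] by (simp add: C_def D_def)
    qed
    assume small: "C * sqrt (2 * C\<^sup>2 * exp (- \<beta> * (\<delta> - 2 * (3 * \<gamma> \<beta>)))) \<le> 1 / 2"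
    have hit: "1 / 2 \<le> hit_lim (below (height y z)) z y" for y z
      using hit_bound[OF order_refl \<delta>(2), of y z] small unfolding C_def by linarith
    have "\<exists>T. c / (4 * C\<^sup>2) * exp (\<beta> * (D - 2 * (3 * \<gamma> \<beta>))) \<le> (\<Sum>k<T. survival (N i) k r)"
      unfolding C_def D_def by (rule exit_sum_lower[OF hit assms(4-6) c(1)]) (rule c(2))
    then obtain T where "c / (4 * C\<^sup>2) * exp (\<beta> * (D - 6 * \<gamma> \<beta>)) \<le> (\<Sum>k<T. survival (N i) k r)"
      by auto
    then have "ennreal (c / (4 * C\<^sup>2) * exp (\<beta> * (D - 6 * \<gamma> \<beta>))) \<le> (\<Sum>k<T. ennreal (survival (N i) k r))"
      unfolding part by (rule ennreal_leI)
    also have "\<dots> \<le> (\<Sum>k. ennreal (survival (N i) k r))" by (rule sum_le_suminf) auto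
    finally show "ennreal (c / (4 * C\<^sup>2) * exp (\<beta> * (D - 6 * \<gamma> \<beta>))) \<le> expected_zeta0 (P \<beta> r) (N i) (X \<beta>)"
      unfolding exp_eq .
  qed
  have "((\<lambda>\<beta>. 6 * \<gamma> \<beta>) \<longlongrightarrow> 6 * 0) at_top" by (intro tendsto_intros chain.gamma_lim)
  then have a: "((\<lambda>\<beta>. 6 * \<gamma> \<beta>) \<longlongrightarrow> 0) at_top" by simp
  have "((\<lambda>\<beta>. ereal (1 / \<beta>) * ln_ennreal (expected_zeta0 (P \<beta> r) (N i) (X \<beta>))) \<longlongrightarrow> ereal D) at_top"
  proof (rule log_limit[OF a, of "c / (4 * C\<^sup>2)" "2 * C ^ 3"])
    show "\<forall>\<^sub>F \<beta> in at_top. ennreal (c / (4 * C\<^sup>2) * exp (\<beta> * (D - 6 * \<gamma> \<beta>)))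
        \<le> expected_zeta0 (P \<beta> r) (N i) (X \<beta>)"
      using eventually_gt_at_top[of 0] chain.hit_error_eventually[OF \<delta>(1), of C "2 * C\<^sup>2"]
      by eventually_elim (rule lower)
    show "\<forall>\<^sub>F \<beta> in at_top. expected_zeta0 (P \<beta> r) (N i) (X \<beta>)
        \<le> ennreal (2 * C ^ 3 * exp (\<beta> * (D + 6 * \<gamma> \<beta>)))"
      using eventually_gt_at_top[of 0] by eventually_elim (rule upper)
  qed (use c C0 in simp_all)
  then show ?thesis using exit_energy[OF assms(4-6)] by (simp add: D_def)
qed

end
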